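(* (i) Let $f:(u_1,u_2)\times\mathbb{R}\to\mathbb{R}^3$ be an intrinsic surface of revolution of constant mean curvature $H=\lambda_1+\lambda_2$, with first fundamental form $I_\rho$ for $\rho:(u_1,u_2)\to\mathbb{R}^{>0}$, and with linear twist $\alpha(v)=av$. Then there is a constant $b\in\mathbb{R}$ such that $\rho$ satisfies $$\rho'(u)^2-\rho(u)\rho''(u)=\tfrac14H^2\rho(u)^4-b^2e^{4au}\quad\text{for all }u\in(u_1,u_2).\qquad( * )$$ (ii) Conversely, let $H\in\mathbb{R}$, $\alpha(v)=av$ with $a\in\mathbb{R}$, a constant $b\in\mathbb{R}$, and a function $\rho:(u_1,u_2)\to\mathbb{R}^{>0}$ satisfying $( * )$ be given, and define $$\lambda_{1}(u)=\tfrac12H+ b\frac{e^{2au}}{\rho(u)^2},\qquad \lambda_{2}(u)=\tfrac12H- b\frac{e^{2au}}{\rho(u)^2}.$$ Then the first fundamental form $I_\rho$ and the shape operator $S=R^{-\alpha(v)}\begin{pmatrix}\lambda_1(u)&0\\0&\lambda_2(u)\end{pmatrix}R^{\alpha(v)}$ satisfy the Gauss and Codazzi equations and thus define an intrinsic surface of revolution (an immersion $(u_1,u_2)\times\mathbb{R}\to\mathbb{R}^3$ with first fundamental form $I_\rho$ and shape operator $S$) with twist $\alpha(v)=av$ and constant mean curvature $H$.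
   Context: Surfaces are three times continuously differentiable immersions $f:(u_1,u_2)\times\mathbb{R}\to\mathbb{R}^3$, with coordinates $(u,v)$. Such a surface is an intrinsic surface of revolution if its first fundamental form is $I_\rho=\rho(u)^2(du^2+dv^2)$ for a positive function $\rho$ of $u$ alone. Let $R^{\theta}=\begin{pmatrix}\cos\theta&-\sin\theta\\ \sin\theta&\cos\theta\end{pmatrix}$. For a $C^1$ function $\alpha:\mathbb{R}\to\mathbb{R}$, the surface has twist $\alpha$ if the matrix of its shape operator with respect to the coordinate basis $(\partial/\partial u,\partial/\partial v)$ is $S=R^{-\alpha(v)}\operatorname{diag}(\lambda_1(u),\lambda_2(u))R^{\alpha(v)}$ for functions $\lambda_1,\lambda_2$ of $u$ alone. The mean curvature is normalized as $H=\lambda_1+\lambda_2$ (not averaged). The Gauss equation says that the Gauss curvature of $I_\rho$ equals $\det S$; the Codazzi equations say $(D_XS)Y=(D_YS)X$ for all tangent vectors $X,Y$, where $D$ is the Levi-Civita connection of $I_\rho$. *)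

theory Defs
  imports "HOL-Analysis.Analysis"
begin

text \<open>A point \<open>p :: real^2\<close> carries the coordinates \<open>u = p$1\<close>, \<open>v = p$2\<close>. The endpoints of the
  \<open>u\<close>-interval are extended reals, so that unbounded intervals are included.\<close>

definition strip :: "ereal \<Rightarrow> ereal \<Rightarrow> (real^2) set" where
  "strip u1 u2 = {p. p$1 \<in> einterval u1 u2}"

definition partial :: "2 \<Rightarrow> (real^2 \<Rightarrow> 'b::real_normed_vector) \<Rightarrow> real^2 \<Rightarrow> 'b" where
  "partial i F p = frechet_derivative F (at p) (axis i 1)"

text \<open>\<open>k\<close> times continuously differentiable; only used for open \<open>U\<close>.\<close>

primrec ck_on :: "nat \<Rightarrow> (real^2) set \<Rightarrow> (real^2 \<Rightarrow> 'b::real_normed_vector) \<Rightarrow> bool" where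
  "ck_on 0 U F \<longleftrightarrow> continuous_on U F"
| "ck_on (Suc k) U F \<longleftrightarrow> F differentiable_on U \<and> (\<forall>i. ck_on k U (partial i F))"


section \<open>Riemannian metrics on plane domains\<close>

text \<open>A metric is given by its Gram matrix with respect to the coordinate basis, an endomorphism
  field by its matrix, and a vector field by its components.\<close>

type_synonym metric = "real^2 \<Rightarrow> real^2^2"
type_synonym endo_field = "real^2 \<Rightarrow> real^2^2"
type_synonym vec_field = "real^2 \<Rightarrow> real^2"

text \<open>\<open>christoffel g k i j\<close> has upper index \<open>k\<close> and lower indices \<open>i\<close>, \<open>j\<close>.\<close>

definition christoffel :: "metric \<Rightarrow> 2 \<Rightarrow> 2 \<Rightarrow> 2 \<Rightarrow> real^2 \<Rightarrow> real" where
  "christoffel g k i j p = (1/2) * (\<Sum>l\<in>UNIV. matrix_inv (g p) $ k $ l *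
     (partial i (\<lambda>q. g q $ l $ j) p + partial j (\<lambda>q. g q $ l $ i) p - partial l (\<lambda>q. g q $ i $ j) p))"

definition levi_civita :: "metric \<Rightarrow> vec_field \<Rightarrow> vec_field \<Rightarrow> vec_field" where
  "levi_civita g X Y p = frechet_derivative Y (at p) (X p)
     + (\<chi> k. \<Sum>i\<in>UNIV. \<Sum>j\<in>UNIV. christoffel g k i j p * X p $ i * Y p $ j)"

text \<open>The covariant derivative of an endomorphism field: \<open>(D\<^sub>X S) Y = D\<^sub>X (S Y) - S (D\<^sub>X Y)\<close>.\<close>

definition cov_deriv_endo :: "metric \<Rightarrow> endo_field \<Rightarrow> vec_field \<Rightarrow> vec_field \<Rightarrow> vec_field" where
  "cov_deriv_endo g S X Y p = levi_civita g X (\<lambda>q. S q *v Y q) p - S p *v levi_civita g X Y p"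

definition coord_field :: "2 \<Rightarrow> vec_field" where
  "coord_field i = (\<lambda>_. axis i 1)"

text \<open>With \<open>R(X,Y) Z = D\<^sub>X D\<^sub>Y Z - D\<^sub>Y D\<^sub>X Z - D\<^bsub>[X,Y]\<^esub> Z\<close>, the sectional curvature
  \<open>g (R(X,Y) Y, X) / (g(X,X) g(Y,Y) - g(X,Y)\<^sup>2)\<close> for the coordinate fields \<open>X = \<partial>/\<partial>u\<close>,
  \<open>Y = \<partial>/\<partial>v\<close>, whose bracket vanishes.\<close>

definition gauss_curvature :: "metric \<Rightarrow> real^2 \<Rightarrow> real" where
  "gauss_curvature g p =
     (g p *v (levi_civita g (coord_field 1) (levi_civita g (coord_field 2) (coord_field 2)) p
            - levi_civita g (coord_field 2) (levi_civita g (coord_field 1) (coord_field 2)) p))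
       \<bullet> coord_field 1 p / det (g p)"

definition gauss_equation :: "(real^2) set \<Rightarrow> metric \<Rightarrow> endo_field \<Rightarrow> bool" where
  "gauss_equation U g S \<longleftrightarrow> (\<forall>p\<in>U. gauss_curvature g p = det (S p))"

text \<open>Tangent vectors at \<open>p\<close> are taken as the values of arbitrary vector fields that are
  differentiable at \<open>p\<close>.\<close>

definition codazzi_equations :: "(real^2) set \<Rightarrow> metric \<Rightarrow> endo_field \<Rightarrow> bool" where
  "codazzi_equations U g S \<longleftrightarrow>
     (\<forall>p\<in>U. \<forall>X Y. X differentiable (at p) \<longrightarrow> Y differentiable (at p) \<longrightarrow>
        cov_deriv_endo g S X Y p = cov_deriv_endo g S Y X p)"


section \<open>Surfaces in Euclidean space\<close>

definition c3_immersion :: "(real^2) set \<Rightarrow> (real^2 \<Rightarrow> real^3) \<Rightarrow> bool" where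
  "c3_immersion U f \<longleftrightarrow> ck_on 3 U f \<and> (\<forall>p\<in>U. inj (frechet_derivative f (at p)))"

definition first_fundamental_form :: "(real^2 \<Rightarrow> real^3) \<Rightarrow> metric" where
  "first_fundamental_form f p = transpose (jacobian f (at p)) ** jacobian f (at p)"

definition gauss_map :: "(real^2 \<Rightarrow> real^3) \<Rightarrow> real^2 \<Rightarrow> real^3" where
  "gauss_map f p = sgn (cross3 (partial 1 f p) (partial 2 f p))"

text \<open>The matrix \<open>S\<close> of the shape operator with respect to the coordinate basis:
  \<open>df (S X) = - dn (X)\<close>. The sign is a convention: replacing \<open>f\<close> by \<open>- f\<close> keeps the Gauss map
  and the first fundamental form and changes the sign of \<open>S\<close>.\<close>

definition shape_operator :: "(real^2 \<Rightarrow> real^3) \<Rightarrow> endo_field" where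
  "shape_operator f p =
     (THE S. jacobian f (at p) ** S = - jacobian (gauss_map f) (at p))"

text \<open>The sum of the principal curvatures, not their average.\<close>

definition mean_curvature :: "(real^2 \<Rightarrow> real^3) \<Rightarrow> real^2 \<Rightarrow> real" where
  "mean_curvature f p = trace (shape_operator f p)"


section \<open>Intrinsic surfaces of revolution\<close>

text \<open>The metric \<open>\<rho>(u)\<^sup>2 (du\<^sup>2 + dv\<^sup>2)\<close>.\<close>

definition revolution_metric :: "(real \<Rightarrow> real) \<Rightarrow> metric" where
  "revolution_metric \<rho> p = mat ((\<rho> (p$1))\<^sup>2)"

definition intrinsic_surface_of_revolution ::
    "ereal \<Rightarrow> ereal \<Rightarrow> (real \<Rightarrow> real) \<Rightarrow> (real^2 \<Rightarrow> real^3) \<Rightarrow> bool" where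
  "intrinsic_surface_of_revolution u1 u2 \<rho> f \<longleftrightarrow>
     c3_immersion (strip u1 u2) f \<and>
     (\<forall>u\<in>einterval u1 u2. \<rho> u > 0) \<and>
     (\<forall>p\<in>strip u1 u2. first_fundamental_form f p = revolution_metric \<rho> p)"

definition rot :: "real \<Rightarrow> real^2^2" where
  "rot \<theta> = vector [vector [cos \<theta>, - sin \<theta>], vector [sin \<theta>, cos \<theta>]]"

definition twisted_diag ::
    "(real \<Rightarrow> real) \<Rightarrow> (real \<Rightarrow> real) \<Rightarrow> (real \<Rightarrow> real) \<Rightarrow> endo_field" where
  "twisted_diag \<alpha> lam1 lam2 p =
     rot (- \<alpha> (p$2)) ** vector [vector [lam1 (p$1), 0], vector [0, lam2 (p$1)]] ** rot (\<alpha> (p$2))"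

text \<open>The surface has twist \<open>\<alpha>\<close>, with principal curvatures \<open>lam1\<close>, \<open>lam2\<close>.\<close>

definition has_twist ::
    "ereal \<Rightarrow> ereal \<Rightarrow> (real^2 \<Rightarrow> real^3) \<Rightarrow> (real \<Rightarrow> real) \<Rightarrow> (real \<Rightarrow> real) \<Rightarrow> (real \<Rightarrow> real) \<Rightarrow> bool" where
  "has_twist u1 u2 f \<alpha> lam1 lam2 \<longleftrightarrow>
     \<alpha> C1_differentiable_on UNIV \<and>
     (\<forall>p\<in>strip u1 u2. shape_operator f p = twisted_diag \<alpha> lam1 lam2 p)"

definition cmc_profile_equation ::
    "ereal \<Rightarrow> ereal \<Rightarrow> real \<Rightarrow> real \<Rightarrow> real \<Rightarrow> (real \<Rightarrow> real) \<Rightarrow> bool" where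
  "cmc_profile_equation u1 u2 H a b \<rho> \<longleftrightarrow>
     (\<exists>\<rho>' \<rho>''. \<forall>u\<in>einterval u1 u2.
        (\<rho> has_real_derivative \<rho>' u) (at u) \<and> (\<rho>' has_real_derivative \<rho>'' u) (at u) \<and>
        (\<rho>' u)\<^sup>2 - \<rho> u * \<rho>'' u = 1/4 * H\<^sup>2 * \<rho> u ^ 4 - b\<^sup>2 * exp (4 * a * u))"

end

theory Submission
  imports Defs
begin

text \<open>
  Write \<open>w = \<rho>'/\<rho>\<close>. A shape operator of the given form with trace \<open>H\<close> is
  \<open>S = (H/2) 1 + \<mu>(u) R(-\<alpha>) diag(1,-1) R(\<alpha>)\<close>, so its trace-free part is a rotating reflection of
  size \<open>\<mu>\<close>, and \<open>det S = H\<^sup>2/4 - \<mu>\<^sup>2\<close>. For a linear twist, the Codazzi equations with constant \<open>H\<close>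
  reduce to \<open>(\<rho>\<^sup>2 \<mu>)' = 2 a \<rho>\<^sup>2 \<mu>\<close>, that is \<open>\<rho>\<^sup>2 \<mu> = b exp(2 a u)\<close> (this is the holomorphy of the Hopf
  differential, which is \<open>b exp(2 a (u + i v))\<close>). The curvature of \<open>\<rho>\<^sup>2 (du\<^sup>2 + dv\<^sup>2)\<close> is
  \<open>- w'/\<rho>\<^sup>2 = (\<rho>'\<^sup>2 - \<rho> \<rho>'')/\<rho>\<^sup>4\<close>, so the Gauss equation is then exactly the profile equation.

  Part (i), \<open>cmc_twisted_profile\<close>, derives these two equations from the commutation of the third
  derivatives of \<open>f\<close> (\<open>partial_commute\<close>). The function \<open>\<rho>\<close> and the principal curvatures come with no
  smoothness at all; they inherit it from the entries of the two fundamental forms.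

  In part (ii), the Gauss and Codazzi equations are a computation with the Levi-Civita connection
  (\<open>levi_civita_revolution_metric\<close>). The immersion itself needs Bonnet's theorem for this
  metric and this shape operator. The orthonormal frame \<open>e\<^sub>1 = f\<^sub>u/\<rho>\<close>, \<open>e\<^sub>2 = f\<^sub>v/\<rho>\<close>, \<open>n\<close> together with the position \<open>f\<close>
  satisfies a linear system \<open>X\<^sub>u = A X\<close>, \<open>X\<^sub>v = B X\<close> with known coefficients, whose compatibility condition
  \<open>A\<^sub>v + A B = B\<^sub>u + B A\<close> is again Gauss plus Codazzi (\<open>compatibility\<close>). Since \<open>f\<close> is one of
  the unknowns, the closed form \<open>df\<close> is integrated along with the frame.

  Compatible systems are solved in \<open>overdetermined_linear_system_solvable\<close>: integrate first along
  the \<open>u\<close>-axis, then along every line \<open>u = const\<close>. For the \<open>u\<close>-derivative,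
  compare the solution on the line \<open>u + h\<close> with \<open>(1 + h A) X\<close> taken on the line \<open>u\<close>: by compatibility
  the latter solves the equation of the line \<open>u + h\<close> up to an error \<open>o(h)\<close>, so by Gronwall's inequality
  the two differ by \<open>o(h)\<close>.
\<close>

section \<open>Linear systems of ordinary differential equations\<close>

lemma bounded_bilinear_matrix_mult:
  "bounded_bilinear ((**) :: real^'n^'m \<Rightarrow> real^'k^'n \<Rightarrow> real^'k^'m)"
  unfolding bilinear_conv_bounded_bilinear[symmetric] bilinear_def linear_iff
  by (auto simp: vec_eq_iff matrix_matrix_mult_def algebra_simps sum.distrib sum_distrib_left)

interpretation mm: bounded_bilinear "(**) :: real^'n^'m \<Rightarrow> real^'k^'n \<Rightarrow> real^'k^'m"
  by (rule bounded_bilinear_matrix_mult)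

lemma matrix_mult_bounded_on_compact:
  fixes A :: "'t::topological_space \<Rightarrow> real^'n^'m"
  assumes "compact S" "continuous_on S A"
  obtains M where "M > 0" "\<And>t (x :: real^'k^'n). t \<in> S \<Longrightarrow> norm (A t ** x) \<le> M * norm x"
proof -
  obtain K where K: "K > 0" "\<And>(a :: real^'n^'m) (x :: real^'k^'n). norm (a ** x) \<le> norm a * norm x * K"
    using mm.pos_bounded by blast
  have "bounded (A ` S)"
    using assms compact_continuous_image compact_imp_bounded by blast
  then obtain N where N: "N > 0" "\<And>t. t \<in> S \<Longrightarrow> norm (A t) \<le> N"
    by (auto simp: bounded_pos)
  show thesis
  proof (rule that)
    show "N * K > 0" using N K by simp
    fix t and x :: "real^'k^'n" assume "t \<in> S"
    have "norm (A t ** x) \<le> norm (A t) * norm x * K" by (rule K)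
    also have "\<dots> \<le> N * norm x * K"
      using N(2)[OF \<open>t \<in> S\<close>] K(1) by (intro mult_right_mono) auto
    finally show "norm (A t ** x) \<le> N * K * norm x" by (simp add: ac_simps)
  qed
qed

text \<open>The induction step of the bound on the Picard iterates. The segment from \<open>t0\<close> to \<open>t\<close> is
  parametrized by \<open>[0,1]\<close> so that points on both sides of \<open>t0\<close> are treated alike.\<close>

lemma norm_le_power_of_derivative_le:
  fixes f :: "real \<Rightarrow> 'a::real_normed_vector"
  assumes der: "\<And>s. s \<in> closed_segment t0 t \<Longrightarrow> (f has_vector_derivative f' s) (at s)"
    and bd: "\<And>s. s \<in> closed_segment t0 t \<Longrightarrow> norm (f' s) \<le> C * \<bar>s - t0\<bar> ^ n"
    and 0: "f t0 = 0"
  shows "norm (f t) \<le> C * \<bar>t - t0\<bar> ^ Suc n / Suc n"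
proof -
  define L where "L = t - t0"
  define g where "g = (\<lambda>r. f (t0 + r * L))"
  have seg: "t0 + r * L \<in> closed_segment t0 t" if "0 \<le> r" "r \<le> 1" for r
    unfolding closed_segment_def L_def using that by (auto intro!: exI[of _ r] simp: algebra_simps)
  have dg: "(g has_vector_derivative L *\<^sub>R f' (t0 + r * L)) (at r)" if "0 \<le> r" "r \<le> 1" for r
  proof -
    have "((\<lambda>r. t0 + r * L) has_vector_derivative L) (at r)"
      by (auto intro!: derivative_eq_intros simp: has_real_derivative_iff_has_vector_derivative[symmetric])
    from vector_diff_chain_at[OF this der[OF seg[OF that]]] show ?thesis
      by (simp add: g_def o_def)
  qed
  have "norm (g 1 - g 0) \<le> C * \<bar>L\<bar> ^ Suc n * 1 ^ Suc n / Suc n - C * \<bar>L\<bar> ^ Suc n * 0 ^ Suc n / Suc n"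
  proof (rule differentiable_bound_general[where f = g and \<phi> = "\<lambda>r. C * \<bar>L\<bar> ^ Suc n * r ^ Suc n / Suc n"
        and f' = "\<lambda>r. L *\<^sub>R f' (t0 + r * L)" and \<phi>' = "\<lambda>r. C * \<bar>L\<bar> ^ Suc n * r ^ n"])
    show "continuous_on {0..1} g"
      using has_vector_derivative_continuous[OF dg] by (intro continuous_at_imp_continuous_on) auto
    show "continuous_on {0..1} (\<lambda>r. C * \<bar>L\<bar> ^ Suc n * r ^ Suc n / Suc n)"
      by (intro continuous_intros) auto
    fix r :: real assume r: "0 < r" "r < 1"
    show "(g has_vector_derivative L *\<^sub>R f' (t0 + r * L)) (at r)" using dg r by simp
    show "((\<lambda>r. C * \<bar>L\<bar> ^ Suc n * r ^ Suc n / Suc n) has_vector_derivative C * \<bar>L\<bar> ^ Suc n * r ^ n) (at r)"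
      unfolding has_real_derivative_iff_has_vector_derivative[symmetric]
      by (rule derivative_eq_intros refl | simp del: of_nat_Suc)+
    have "norm (f' (t0 + r * L)) \<le> C * \<bar>t0 + r * L - t0\<bar> ^ n" by (rule bd) (use seg[of r] r in auto)
    then have "\<bar>L\<bar> * norm (f' (t0 + r * L)) \<le> \<bar>L\<bar> * (C * \<bar>t0 + r * L - t0\<bar> ^ n)"
      by (intro mult_left_mono) auto
    also have "\<dots> = C * \<bar>L\<bar> ^ Suc n * r ^ n"
      using r by (simp add: abs_mult power_mult_distrib)
    finally show "norm (L *\<^sub>R f' (t0 + r * L)) \<le> C * \<bar>L\<bar> ^ Suc n * r ^ n" by simp
  qed simp
  then show ?thesis using 0 by (simp add: g_def L_def)
qed

lemma einterval_enclosing_Icc: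
  assumes "s \<in> einterval a b" "t \<in> einterval a b"
  obtains c d where "c < s" "s < d" "c < t" "t < d" "{c..d} \<subseteq> einterval a b"
proof -
  have "open (einterval a b)" by simp
  then obtain e1 e2 where e: "e1 > 0" "cball s e1 \<subseteq> einterval a b" "e2 > 0" "cball t e2 \<subseteq> einterval a b"
    using assms open_contains_cball by metis
  define e where "e = min e1 e2"
  have "s - e \<in> einterval a b" "s + e \<in> einterval a b" "t - e \<in> einterval a b" "t + e \<in> einterval a b"
    using e by (auto simp: e_def subset_iff dist_real_def)
  then have m: "min s t - e \<in> einterval a b" "max s t + e \<in> einterval a b"
    by (auto simp: min_def max_def)
  have "r \<in> einterval a b" if "r \<in> {min s t - e..max s t + e}" for r
  proof -
    have "ereal (min s t - e) \<le> ereal r" "ereal r \<le> ereal (max s t + e)" using that by auto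
    with m show ?thesis unfolding einterval_iff by (meson le_less_trans less_le_trans)
  qed
  then have "{min s t - e..max s t + e} \<subseteq> einterval a b" by blast
  then show thesis using e by (intro that[of "min s t - e" "max s t + e"]) (auto simp: e_def)
qed

text \<open>Picard's series \<open>\<Sum> \<phi>\<^sub>n\<close> with \<open>\<phi>\<^sub>n\<^sub>+\<^sub>1' = A \<phi>\<^sub>n\<close>. On a compact subinterval of length \<open>l\<close> on which \<open>A\<close> has
  operator norm at most \<open>M\<close>, the terms are bounded by \<open>\<bar>x0\<bar>\<close> times those of \<open>exp (M l)\<close>. Since the equation is
  linear, this gives the solution on the whole, possibly unbounded, interval.\<close>

theorem linear_ode_exists:
  fixes A :: "real \<Rightarrow> real^'n^'n" and x0 :: "real^'m^'n"
  assumes cont: "continuous_on (einterval a b) A" and t0: "t0 \<in> einterval a b"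
  obtains X where "X t0 = x0"
    "\<And>t. t \<in> einterval a b \<Longrightarrow> (X has_vector_derivative A t ** X t) (at t)"
proof -
  let ?I = "einterval a b"
  have "a < b" using t0 by (auto simp: einterval_iff intro: less_trans)
  have "\<exists>F. F t0 = 0 \<and> (\<forall>t\<in>?I. (F has_vector_derivative f t) (at t))"
    if f: "continuous_on ?I f" for f :: "real \<Rightarrow> real^'m^'n"
  proof -
    obtain F where F: "\<And>t. t \<in> ?I \<Longrightarrow> (F has_vector_derivative f t) (at t)"
      using einterval_antiderivative[OF \<open>a < b\<close>, of f] f
      by (auto simp: einterval_iff continuous_on_eq_continuous_at)
    show ?thesis
      by (rule exI[of _ "\<lambda>t. F t - F t0"]) (auto intro!: derivative_eq_intros F)
  qed
  then obtain J where J: "\<And>f :: real \<Rightarrow> real^'m^'n. continuous_on ?I f \<Longrightarrow>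
      J f t0 = 0 \<and> (\<forall>t\<in>?I. (J f has_vector_derivative f t) (at t))"
    by metis
  define phi :: "nat \<Rightarrow> real \<Rightarrow> real^'m^'n" where
    "phi = rec_nat (\<lambda>_. x0) (\<lambda>_ g. J (\<lambda>t. A t ** g t))"
  have phi0: "phi 0 t = x0" and phiS: "phi (Suc n) = J (\<lambda>t. A t ** phi n t)" for n t
    by (simp_all add: phi_def)
  have phi_cont: "continuous_on ?I (phi n)" for n
  proof (induction n)
    case 0 show ?case by (simp add: phi_def)
  next
    case (Suc n)
    have "continuous_on ?I (\<lambda>t. A t ** phi n t)" by (intro mm.continuous_on cont Suc)
    from J[OF this] show ?case unfolding phiS
      by (intro continuous_at_imp_continuous_on) (auto intro: has_vector_derivative_continuous)
  qed
  have phi_t0: "phi (Suc n) t0 = 0"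
    and phi_der: "t \<in> ?I \<Longrightarrow> (phi (Suc n) has_vector_derivative A t ** phi n t) (at t)" for n t
    using J[OF mm.continuous_on[OF cont phi_cont]] unfolding phiS by auto
  define X where "X = (\<lambda>t. \<Sum>n. phi n t)"
  show thesis
  proof (rule that)
    have "(\<lambda>n. phi n t0) sums (\<Sum>n\<in>{0}. phi n t0)"
      by (rule sums_finite) (use phi_t0 in \<open>auto simp: gr0_conv_Suc\<close>)
    then show "X t0 = x0" by (simp add: X_def sums_iff phi0)
  next
    fix T assume T: "T \<in> ?I"
    obtain c d where cd: "c < T" "T < d" "c < t0" "t0 < d" "{c..d} \<subseteq> ?I"
      using einterval_enclosing_Icc[OF T t0] by metis
    have "compact {c..d}" "continuous_on {c..d} A" using cd cont continuous_on_subset by auto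
    then obtain M where M: "M > 0" "\<And>t x. t \<in> {c..d} \<Longrightarrow> norm (A t ** (x :: real^'m^'n)) \<le> M * norm x"
      using matrix_mult_bounded_on_compact by metis
    have bound: "norm (phi n t) \<le> norm x0 * M ^ n / fact n * \<bar>t - t0\<bar> ^ n" if "t \<in> {c..d}" for n t
      using that
    proof (induction n arbitrary: t)
      case (Suc n)
      have seg: "closed_segment t0 t \<subseteq> {c..d}"
        using Suc.prems cd by (auto simp: closed_segment_eq_real_ivl split: if_splits)
      have "norm (phi (Suc n) t) \<le> M * (norm x0 * M ^ n / fact n) * \<bar>t - t0\<bar> ^ Suc n / Suc n"
      proof (rule norm_le_power_of_derivative_le[where f' = "\<lambda>t. A t ** phi n t"])
        fix s assume "s \<in> closed_segment t0 t"
        then have s: "s \<in> {c..d}" using seg by auto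
        show "(phi (Suc n) has_vector_derivative A s ** phi n s) (at s)"
          using phi_der s cd by auto
        have "norm (A s ** phi n s) \<le> M * norm (phi n s)" by (rule M(2)[OF s])
        also have "\<dots> \<le> M * (norm x0 * M ^ n / fact n * \<bar>s - t0\<bar> ^ n)"
          using Suc.IH[OF s] M(1) by (intro mult_left_mono) auto
        finally show "norm (A s ** phi n s) \<le> M * (norm x0 * M ^ n / fact n) * \<bar>s - t0\<bar> ^ n"
          by (simp add: ac_simps)
      qed (rule phi_t0)
      then show ?case by (simp add: field_simps)
    qed (simp add: phi0)
    define m where "m = (\<lambda>n. norm x0 * (M * (d - c)) ^ n / fact n)"
    have phi_m: "norm (phi n t) \<le> m n" if "t \<in> {c..d}" for n t
    proof -
      have "\<bar>t - t0\<bar> ^ n \<le> (d - c) ^ n" using that cd by (intro power_mono) auto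
      then have "norm x0 * M ^ n / fact n * \<bar>t - t0\<bar> ^ n \<le> norm x0 * M ^ n / fact n * (d - c) ^ n"
        using M(1) by (intro mult_left_mono) auto
      with bound[OF that, of n] show ?thesis by (simp add: m_def power_mult_distrib)
    qed
    have "summable m"
      using summable_mult[OF summable_exp[of "M * (d - c)"], of "norm x0"] by (simp add: m_def field_simps)
    then have unif: "uniform_limit {c..d} (\<lambda>n t. \<Sum>i<n. phi i t) X sequentially"
      unfolding X_def using phi_m by (intro Weierstrass_m_test)
    have sums: "(\<lambda>n. phi n t) sums X t" if "t \<in> {c..d}" for t
      unfolding X_def
      using summable_comparison_test'[OF \<open>summable m\<close>, of 0 "\<lambda>n. phi n t"] phi_m[OF that]
      by (auto intro: summable_sums)
    define phi' where "phi' = (\<lambda>n t. case n of 0 \<Rightarrow> 0 | Suc n \<Rightarrow> A t ** phi n t)"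
    have sum_phi': "(\<Sum>i<Suc n. phi' i t) = A t ** (\<Sum>i<n. phi i t)" for n t
      unfolding sum.lessThan_Suc_shift by (simp add: phi'_def mm.sum_right)
    have "\<exists>g. \<forall>x\<in>{c..d}. (\<lambda>n. phi n x) sums g x \<and>
        (g has_derivative (\<lambda>h. h *\<^sub>R (A x ** X x))) (at x within {c..d})"
    proof (rule has_derivative_series[where x = T and f' = "\<lambda>n t h. h *\<^sub>R phi' n t" and l = "X T"])
      fix n t assume "t \<in> {c..d}"
      then show "(phi n has_derivative (\<lambda>h. h *\<^sub>R phi' n t)) (at t within {c..d})"
        by (cases n) (use phi_der[of t] cd in
            \<open>auto simp: phi'_def phi_def has_vector_derivative_def subset_iff intro: has_derivative_at_withinI\<close>)
    next
      fix e :: real assume "e > 0"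
      then have "\<forall>\<^sub>F n in sequentially. \<forall>t\<in>{c..d}. norm ((\<Sum>i<n. phi i t) - X t) < e / M"
        using uniform_limitD[OF unif, of "e / M"] M(1) by (simp add: dist_norm)
      then have "\<forall>\<^sub>F n in sequentially. \<forall>t\<in>{c..d}. \<forall>h.
          norm ((\<Sum>i<Suc n. h *\<^sub>R phi' i t) - h *\<^sub>R (A t ** X t)) \<le> e * norm h"
      proof eventually_elim
        case (elim n)
        show ?case
        proof (intro ballI allI)
          fix t h assume t: "t \<in> {c..d}"
          have "norm ((\<Sum>i<Suc n. h *\<^sub>R phi' i t) - h *\<^sub>R (A t ** X t))
              = norm (h *\<^sub>R (A t ** ((\<Sum>i<n. phi i t) - X t)))"
            by (simp only: scaleR_sum_right[symmetric] sum_phi' scaleR_diff_right[symmetric] mm.diff_right)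
          also have "\<dots> \<le> \<bar>h\<bar> * (M * norm ((\<Sum>i<n. phi i t) - X t))"
            using M(2)[OF t] by (simp add: mult_left_mono)
          also have "\<dots> \<le> \<bar>h\<bar> * (M * (e / M))"
            using elim t M(1) by (intro mult_left_mono) (auto intro: less_imp_le)
          finally show "norm ((\<Sum>i<Suc n. h *\<^sub>R phi' i t) - h *\<^sub>R (A t ** X t)) \<le> e * norm h"
            using M(1) by (simp add: ac_simps)
        qed
      qed
      then show "\<forall>\<^sub>F n in sequentially. \<forall>t\<in>{c..d}. \<forall>h.
          norm ((\<Sum>i<n. h *\<^sub>R phi' i t) - h *\<^sub>R (A t ** X t)) \<le> e * norm h"
        by (rule eventually_sequentially_Suc[THEN iffD1])
    qed (use cd sums in auto)
    then obtain g where g: "\<And>t. t \<in> {c..d} \<Longrightarrow> (\<lambda>n. phi n t) sums g t"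
      "\<And>t. t \<in> {c..d} \<Longrightarrow> (g has_derivative (\<lambda>h. h *\<^sub>R (A t ** X t))) (at t within {c..d})"
      by blast
    have gX: "g t = X t" if "t \<in> {c..d}" for t using g(1) sums that sums_unique2 by blast
    have "(X has_derivative (\<lambda>h. h *\<^sub>R (A T ** X T))) (at T within {c..d})"
      by (rule has_derivative_transform[OF _ _ g(2)]) (use cd gX in auto)
    moreover have "at T within {c..d} = at T" using cd by (intro at_within_interior) auto
    ultimately show "(X has_vector_derivative A T ** X T) (at T)"
      by (simp add: has_vector_derivative_def)
  qed
qed

text \<open>With \<open>K = 2 M + 1\<close>, the function \<open>(\<bar>Z\<bar>\<^sup>2 + \<delta>\<^sup>2) exp (- K s)\<close> decreases, because
  \<open>2 Z \<bullet> Z' \<le> 2 M \<bar>Z\<bar>\<^sup>2 + 2 \<delta> \<bar>Z\<bar> \<le> K (\<bar>Z\<bar>\<^sup>2 + \<delta>\<^sup>2)\<close>. Working with the square avoids the points where the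
  norm is not differentiable.\<close>

lemma gronwall_forward:
  fixes Z :: "real \<Rightarrow> 'a::real_inner"
  assumes der: "\<And>s. 0 \<le> s \<Longrightarrow> s \<le> t \<Longrightarrow> (Z has_vector_derivative Z' s) (at s)"
    and bd: "\<And>s. 0 \<le> s \<Longrightarrow> s \<le> t \<Longrightarrow> norm (Z' s) \<le> M * norm (Z s) + \<delta>"
    and init: "norm (Z 0) \<le> \<delta>" and t: "0 \<le> t" and M: "0 \<le> M"
  shows "(norm (Z t))\<^sup>2 \<le> 2 * \<delta>\<^sup>2 * exp ((2 * M + 1) * t)"
proof -
  define K where "K = 2 * M + 1"
  define D where "D = (\<lambda>s. (Z s \<bullet> Z s + \<delta>\<^sup>2) * exp (- K * s))"
  define D' where "D' = (\<lambda>s. (2 * (Z s \<bullet> Z' s) - K * (Z s \<bullet> Z s + \<delta>\<^sup>2)) * exp (- K * s))"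
  have D: "(D has_real_derivative D' s) (at s)" if "0 \<le> s" "s \<le> t" for s
  proof -
    have "((\<lambda>s. Z s \<bullet> Z s) has_vector_derivative (Z s \<bullet> Z' s + Z' s \<bullet> Z s)) (at s)"
      using bounded_bilinear.has_vector_derivative[OF bounded_bilinear_inner der[OF that] der[OF that]] .
    then have "((\<lambda>s. Z s \<bullet> Z s) has_real_derivative 2 * (Z s \<bullet> Z' s)) (at s)"
      by (simp add: has_real_derivative_iff_has_vector_derivative inner_commute)
    then show ?thesis unfolding D_def D'_def
      by (auto intro!: derivative_eq_intros simp: algebra_simps)
  qed
  have D'0: "D' s \<le> 0" if "0 \<le> s" "s \<le> t" for s
  proof -
    let ?n = "norm (Z s)"
    have "Z s \<bullet> Z' s \<le> ?n * norm (Z' s)" by (rule norm_cauchy_schwarz)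
    also have "\<dots> \<le> ?n * (M * ?n + \<delta>)" using bd[OF that] by (intro mult_left_mono) auto
    finally have "2 * (Z s \<bullet> Z' s) \<le> 2 * M * ?n\<^sup>2 + 2 * ?n * \<delta>"
      by (simp add: power2_eq_square algebra_simps)
    also have "\<dots> \<le> 2 * M * ?n\<^sup>2 + (?n\<^sup>2 + \<delta>\<^sup>2)"
      using sum_squares_bound[of ?n \<delta>] by simp
    finally have *: "2 * (Z s \<bullet> Z' s) \<le> 2 * M * ?n\<^sup>2 + (?n\<^sup>2 + \<delta>\<^sup>2)" .
    have "2 * (Z s \<bullet> Z' s) - K * (Z s \<bullet> Z s + \<delta>\<^sup>2) \<le> - (2 * M * \<delta>\<^sup>2)"
      using * by (simp add: K_def power2_norm_eq_inner algebra_simps)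
    also have "\<dots> \<le> 0" using M by simp
    finally show ?thesis by (simp add: D'_def mult_nonpos_nonneg)
  qed
  have "D t \<le> D 0" by (rule DERIV_nonpos_imp_nonincreasing[OF t]) (use D D'0 in blast)
  then have "(norm (Z t))\<^sup>2 + \<delta>\<^sup>2 \<le> ((norm (Z 0))\<^sup>2 + \<delta>\<^sup>2) * exp (K * t)"
    by (simp add: D_def power2_norm_eq_inner exp_minus field_simps)
  also have "\<dots> \<le> (\<delta>\<^sup>2 + \<delta>\<^sup>2) * exp (K * t)"
    using init by (intro mult_right_mono add_right_mono power_mono) auto
  finally show ?thesis unfolding K_def by (smt (verit) zero_le_power2)
qed

lemma gronwall_estimate:
  fixes Z :: "real \<Rightarrow> 'a::real_inner"
  assumes der: "\<And>s. s \<in> closed_segment 0 t \<Longrightarrow> (Z has_vector_derivative Z' s) (at s)"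
    and bd: "\<And>s. s \<in> closed_segment 0 t \<Longrightarrow> norm (Z' s) \<le> M * norm (Z s) + \<delta>"
    and init: "norm (Z 0) \<le> \<delta>" and M: "0 \<le> M"
  shows "norm (Z t) \<le> 2 * \<delta> * exp ((2 * M + 1) * \<bar>t\<bar>)"
proof -
  have sq: "(norm (Z t))\<^sup>2 \<le> 2 * \<delta>\<^sup>2 * exp ((2 * M + 1) * \<bar>t\<bar>)"
  proof (cases "0 \<le> t")
    case True
    then show ?thesis
      using gronwall_forward[where Z = Z and t = t and Z' = Z' and M = M and \<delta> = \<delta>] der bd init M
      by (simp add: closed_segment_eq_real_ivl)
  next
    case False
    have "(norm (Z (- (- t))))\<^sup>2 \<le> 2 * \<delta>\<^sup>2 * exp ((2 * M + 1) * (- t))"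
    proof (rule gronwall_forward[where Z = "\<lambda>s. Z (- s)" and Z' = "\<lambda>s. - Z' (- s)"])
      fix s assume s: "0 \<le> s" "s \<le> - t"
      then have seg: "- s \<in> closed_segment 0 t" using False by (simp add: closed_segment_eq_real_ivl)
      have "((\<lambda>s. - s) has_vector_derivative - 1) (at s)"
        by (auto intro!: derivative_eq_intros)
      from vector_diff_chain_at[OF this der[OF seg]]
      show "((\<lambda>s. Z (- s)) has_vector_derivative - Z' (- s)) (at s)" by (simp add: o_def)
      show "norm (- Z' (- s)) \<le> M * norm (Z (- s)) + \<delta>" using bd[OF seg] by simp
    qed (use False init M in auto)
    then show ?thesis using False by simp
  qed
  have "\<delta> \<ge> 0" using init norm_ge_zero[of "Z 0"] by linarith
  have "exp ((2 * M + 1) * \<bar>t\<bar>) \<ge> 1" using M by simp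
  then have "1 \<le> 2 * exp ((2 * M + 1) * \<bar>t\<bar>)" by linarith
  then have "2 * \<delta>\<^sup>2 * exp ((2 * M + 1) * \<bar>t\<bar>) \<le> 2 * \<delta>\<^sup>2 * (2 * (exp ((2 * M + 1) * \<bar>t\<bar>))\<^sup>2)"
    by (intro mult_left_mono) (auto simp: power2_eq_square)
  with sq have "(norm (Z t))\<^sup>2 \<le> (2 * \<delta> * exp ((2 * M + 1) * \<bar>t\<bar>))\<^sup>2"
    by (simp add: power_mult_distrib)
  then show ?thesis using \<open>\<delta> \<ge> 0\<close> by (simp add: abs_le_square_iff[symmetric])
qed

section \<open>Compatible linear systems in two variables\<close>

definition pt :: "real \<Rightarrow> real \<Rightarrow> real^2" where
  "pt u v = vector [u, v]"

lemma pt_nth [simp]: "pt u v $ 1 = u" "pt u v $ 2 = v"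
  by (simp_all add: pt_def)

lemma pt_eta [simp]: "pt (p $ 1) (p $ 2) = p"
  by (simp add: vec_eq_iff forall_2)

lemma pt_axes: "pt u v = u *\<^sub>R axis 1 1 + v *\<^sub>R axis 2 1"
  by (simp add: vec_eq_iff forall_2 axis_def)

lemma pt_in_strip [simp]: "pt u v \<in> strip a b \<longleftrightarrow> u \<in> einterval a b"
  by (simp add: strip_def)

lemma strip_nth: "p \<in> strip a b \<Longrightarrow> p $ 1 \<in> einterval a b"
  by (simp add: strip_def)

lemma open_strip [simp]: "open (strip a b)"
proof -
  have "strip a b = (\<lambda>p. p $ 1) -` einterval a b" by (auto simp: strip_def)
  then show ?thesis by (auto intro!: open_vimage continuous_intros)
qed

lemma continuous_on_pt [continuous_intros]:
  "continuous_on S f \<Longrightarrow> continuous_on S g \<Longrightarrow> continuous_on S (\<lambda>x. pt (f x) (g x))"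
  unfolding pt_axes by (intro continuous_intros)

lemma has_vector_derivative_partial_u:
  assumes "F differentiable at (pt u v)"
  shows "((\<lambda>s. F (pt s v)) has_vector_derivative partial 1 F (pt u v)) (at u)"
proof -
  have "((\<lambda>s. pt s v) has_derivative (\<lambda>h. h *\<^sub>R axis 1 1)) (at u)"
    unfolding pt_axes by (auto intro!: derivative_eq_intros)
  moreover have D: "(F has_derivative frechet_derivative F (at (pt u v))) (at (pt u v))"
    using assms frechet_derivative_works by blast
  ultimately have "((\<lambda>s. F (pt s v)) has_derivative
      (\<lambda>h. frechet_derivative F (at (pt u v)) (h *\<^sub>R axis 1 1))) (at u)"
    using diff_chain_at[of "\<lambda>s. pt s v" _ u F] by (simp add: o_def)
  then show ?thesis
    by (simp add: has_vector_derivative_def partial_def linear_cmul[OF has_derivative_linear[OF D]])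
qed

lemma has_vector_derivative_partial_v:
  assumes "F differentiable at (pt u v)"
  shows "((\<lambda>s. F (pt u s)) has_vector_derivative partial 2 F (pt u v)) (at v)"
proof -
  have "((\<lambda>s. pt u s) has_derivative (\<lambda>h. h *\<^sub>R axis 2 1)) (at v)"
    unfolding pt_axes by (auto intro!: derivative_eq_intros)
  moreover have D: "(F has_derivative frechet_derivative F (at (pt u v))) (at (pt u v))"
    using assms frechet_derivative_works by blast
  ultimately have "((\<lambda>s. F (pt u s)) has_derivative
      (\<lambda>h. frechet_derivative F (at (pt u v)) (h *\<^sub>R axis 2 1))) (at v)"
    using diff_chain_at[of "\<lambda>s. pt u s" _ v F] by (simp add: o_def)
  then show ?thesis
    by (simp add: has_vector_derivative_def partial_def linear_cmul[OF has_derivative_linear[OF D]])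
qed

lemma ck_on_1: "ck_on 1 U F \<longleftrightarrow> F differentiable_on U \<and> (\<forall>i. continuous_on U (partial i F))"
  unfolding One_nat_def ck_on.simps ..

text \<open>First-order expansion in \<open>u\<close>, uniform for \<open>v\<close> in a compact interval: the mean value
  inequality turns the uniform continuity of \<open>B\<^sub>u\<close> on a compact rectangle into this bound.\<close>

lemma uniform_partial_u_expansion:
  fixes B :: "real^2 \<Rightarrow> 'b::real_normed_vector"
  assumes diff: "B differentiable_on strip a b" and cont: "continuous_on (strip a b) (partial 1 B)"
    and u: "u \<in> einterval a b" and "\<epsilon> > 0"
  obtains d where "d > 0"
    "\<And>h s. \<bar>h\<bar> < d \<Longrightarrow> \<bar>s\<bar> \<le> V \<Longrightarrow> u + h \<in> einterval a b \<and>
       norm (B (pt (u + h) s) - B (pt u s) - h *\<^sub>R partial 1 B (pt u s)) \<le> \<epsilon> * \<bar>h\<bar>"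
proof -
  obtain c1 c2 where c: "c1 < u" "u < c2" "{c1..c2} \<subseteq> einterval a b"
    using einterval_enclosing_Icc[OF u u] by metis
  define R where "R = cbox (pt c1 (- V)) (pt c2 V)"
  have R: "p \<in> R \<longleftrightarrow> c1 \<le> p $ 1 \<and> p $ 1 \<le> c2 \<and> \<bar>p $ 2\<bar> \<le> V" for p
    unfolding R_def mem_box_cart forall_2 pt_nth abs_le_iff by linarith
  have Rs: "R \<subseteq> strip a b" using c(3) by (simp add: subset_iff R strip_def)
  have "uniformly_continuous_on R (partial 1 B)"
    by (rule compact_uniformly_continuous[OF continuous_on_subset[OF cont Rs]]) (simp add: R_def)
  then obtain d where d: "d > 0"
    "\<And>p q. p \<in> R \<Longrightarrow> q \<in> R \<Longrightarrow> dist q p < d \<Longrightarrow> dist (partial 1 B q) (partial 1 B p) < \<epsilon>"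
    using \<open>\<epsilon> > 0\<close> unfolding uniformly_continuous_on_def by metis
  define e where "e = min d (min (u - c1) (c2 - u))"
  show thesis
  proof (rule that)
    show "e > 0" using d c by (simp add: e_def)
    fix h s :: real assume h: "\<bar>h\<bar> < e" and s: "\<bar>s\<bar> \<le> V"
    let ?S = "closed_segment u (u + h)"
    have S: "\<bar>t - u\<bar> < e" if "t \<in> ?S" for t
      using that h by (auto simp: closed_segment_eq_real_ivl split: if_splits)
    have inR: "pt t s \<in> R" if "t \<in> ?S" for t
      using S[OF that] s by (auto simp: R e_def)
    have "norm (B (pt (u + h) s) - B (pt u s) - (u + h - u) *\<^sub>R partial 1 B (pt u s)) \<le> norm (u + h - u) * \<epsilon>"
    proof (rule vector_differentiable_bound_linearization[where S = ?S and f = "\<lambda>t. B (pt t s)" and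
          f' = "\<lambda>t. partial 1 B (pt t s)"])
      fix t assume t: "t \<in> ?S"
      have "B differentiable at (pt t s)"
        using diff inR[OF t] Rs by (auto simp: differentiable_on_eq_differentiable_at)
      then show "((\<lambda>t. B (pt t s)) has_vector_derivative partial 1 B (pt t s)) (at t within ?S)"
        by (rule has_vector_derivative_at_within[OF has_vector_derivative_partial_u])
      have "pt t s - pt u s = (t - u) *\<^sub>R axis 1 1" by (simp add: pt_axes scaleR_left_diff_distrib)
      then have "dist (pt t s) (pt u s) < d" using S[OF t] by (simp add: dist_norm e_def)
      then show "norm (partial 1 B (pt t s) - partial 1 B (pt u s)) \<le> \<epsilon>"
        using d(2)[OF inR inR[OF t], of u] by (simp add: dist_norm less_imp_le)
    qed auto
    then show "u + h \<in> einterval a b \<and>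
       norm (B (pt (u + h) s) - B (pt u s) - h *\<^sub>R partial 1 B (pt u s)) \<le> \<epsilon> * \<bar>h\<bar>"
      using h subsetD[OF c(3), of "u + h"] by (simp add: mult.commute e_def abs_less_iff)
  qed
qed

text \<open>A linear case of Frobenius' theorem: the system is an ordinary differential equation along each
  line \<open>u = const\<close>, and compatibility gives the derivative across these lines. That derivative is obtained
  uniformly on compact parts of the lines, which yields total differentiability.\<close>

theorem overdetermined_linear_system_solvable:
  fixes A B :: "real^2 \<Rightarrow> real^'n^'n" and X0 :: "real^'m^'n"
  assumes A: "ck_on 1 (strip a b) A" and B: "ck_on 1 (strip a b) B"
    and compat: "\<And>p. p \<in> strip a b \<Longrightarrow> partial 2 A p + A p ** B p = partial 1 B p + B p ** A p"
    and t0: "t0 \<in> einterval a b"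
  obtains X where "X (pt t0 0) = X0"
    "\<And>p. p \<in> strip a b \<Longrightarrow>
       (X has_derivative (\<lambda>h. h $ 1 *\<^sub>R (A p ** X p) + h $ 2 *\<^sub>R (B p ** X p))) (at p)"
proof -
  let ?I = "einterval a b"
  have dA: "A differentiable_on strip a b" and dB: "B differentiable_on strip a b"
    and cB1: "continuous_on (strip a b) (partial 1 B)"
    using A[unfolded ck_on_1] B[unfolded ck_on_1] by blast+
  have cA: "continuous_on (strip a b) A" and cB: "continuous_on (strip a b) B"
    using dA dB differentiable_imp_continuous_on by auto
  have "continuous_on ?I (\<lambda>u. A (pt u 0))"
    by (rule continuous_on_compose2[OF cA]) (auto intro!: continuous_intros)
  from linear_ode_exists[OF this t0, of X0] obtain G where
    G: "G t0 = X0" "\<And>u. u \<in> ?I \<Longrightarrow> (G has_vector_derivative A (pt u 0) ** G u) (at u)"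
    by metis
  \<comment> \<open>the lines \<open>u = const\<close>, with the initial values that the solution \<open>G\<close> on the \<open>u\<close>-axis provides\<close>
  have "\<exists>f. f 0 = G u \<and> (\<forall>v. (f has_vector_derivative B (pt u v) ** f v) (at v))" if "u \<in> ?I" for u
  proof -
    have "continuous_on (einterval (- \<infinity>) \<infinity>) (\<lambda>v. B (pt u v))"
      by (rule continuous_on_compose2[OF cB]) (use that in \<open>auto intro!: continuous_intros\<close>)
    from linear_ode_exists[OF this, of 0 "G u"] show ?thesis by (metis einterval_eq(4) UNIV_I)
  qed
  then obtain F where F0: "\<And>u. u \<in> ?I \<Longrightarrow> F u 0 = G u"
    and F: "\<And>u v. u \<in> ?I \<Longrightarrow> (F u has_vector_derivative B (pt u v) ** F u v) (at v)"
    by metis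
  have contF: "continuous_on S (F u)" if "u \<in> ?I" for u S
    using F[OF that] has_vector_derivative_continuous by (intro continuous_at_imp_continuous_on) blast
  have contA: "continuous_on S (\<lambda>v. A (pt u v))" if "u \<in> ?I" for u S
    by (rule continuous_on_compose2[OF cA]) (use that in \<open>auto intro!: continuous_intros\<close>)
  obtain K where K: "K > 0" "\<And>(x :: real^'n^'n) (y :: real^'m^'n). norm (x ** y) \<le> norm x * norm y * K"
    using mm.pos_bounded by blast

  \<comment> \<open>the expansion of the solution in \<open>u\<close>, uniform on compact parts of the lines \<open>u = const\<close>\<close>
  have key: "\<exists>d>0. \<forall>h s. \<bar>h\<bar> < d \<longrightarrow> \<bar>s\<bar> \<le> V \<longrightarrow> u + h \<in> ?I \<and>
      norm (F (u + h) s - F u s - h *\<^sub>R (A (pt u s) ** F u s)) \<le> \<epsilon> * \<bar>h\<bar>"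
    if u: "u \<in> ?I" and "\<epsilon> > 0" and "V > 0" for u \<epsilon> V
  proof -
    obtain c1 c2 where c: "c1 < u" "u < c2" "{c1..c2} \<subseteq> ?I"
      using einterval_enclosing_Icc[OF u u] by metis
    define R where "R = cbox (pt c1 (- V)) (pt c2 V)"
    have R: "p \<in> R \<longleftrightarrow> c1 \<le> p $ 1 \<and> p $ 1 \<le> c2 \<and> \<bar>p $ 2\<bar> \<le> V" for p
      unfolding R_def mem_box_cart forall_2 pt_nth abs_le_iff by linarith
    have Rs: "R \<subseteq> strip a b" using c(3) by (simp add: subset_iff R strip_def)
    have "compact R" by (simp add: R_def)
    obtain M where M: "M > 0" "\<And>p (x :: real^'m^'n). p \<in> R \<Longrightarrow> norm (B p ** x) \<le> M * norm x"
      using matrix_mult_bounded_on_compact[OF \<open>compact R\<close> continuous_on_subset[OF cB Rs]] by metis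
    have "bounded (F u ` {-V..V} \<union> (\<lambda>s. A (pt u s) ** F u s) ` {-V..V})"
      by (auto intro!: compact_imp_bounded compact_continuous_image contF mm.continuous_on contA u)
    then obtain N where N0: "N > 0" "\<And>y. y \<in> F u ` {-V..V} \<union> (\<lambda>s. A (pt u s) ** F u s) ` {-V..V} \<Longrightarrow> norm y \<le> N"
      unfolding bounded_pos by blast
    have N: "N > 0" "\<And>s. \<bar>s\<bar> \<le> V \<Longrightarrow> norm (F u s) \<le> N"
      "\<And>s. \<bar>s\<bar> \<le> V \<Longrightarrow> norm (A (pt u s) ** F u s) \<le> N"
      using N0 by (auto simp: abs_le_iff)
    have "bounded (partial 1 B ` R)"
      using \<open>compact R\<close> continuous_on_subset[OF cB1 Rs] compact_continuous_image compact_imp_bounded by blast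
    then obtain L where L: "L > 0" "\<And>p. p \<in> R \<Longrightarrow> norm (partial 1 B p) \<le> L"
      by (auto simp: bounded_pos)
    \<comment> \<open>\<open>\<eta> \<bar>h\<bar>\<close> will bound the defect of the equation and the initial error; Gronwall's inequality
      multiplies it by at most \<open>2 exp ((2 M + 1) V)\<close>. The defect has two terms, each bounded by \<open>\<zeta> N K \<bar>h\<bar>\<close>.\<close>
    define \<eta> where "\<eta> = \<epsilon> / (2 * exp ((2 * M + 1) * V))"
    define \<zeta> where "\<zeta> = \<eta> / (2 * N * K)"
    have "\<eta> > 0" "\<zeta> > 0" using \<open>\<epsilon> > 0\<close> N K by (auto simp: \<eta>_def \<zeta>_def)
    obtain d1 where d1: "d1 > 0" "\<And>h s. \<bar>h\<bar> < d1 \<Longrightarrow> \<bar>s\<bar> \<le> V \<Longrightarrow> u + h \<in> ?I \<and>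
       norm (B (pt (u + h) s) - B (pt u s) - h *\<^sub>R partial 1 B (pt u s)) \<le> \<zeta> * \<bar>h\<bar>"
      using uniform_partial_u_expansion[OF dB cB1 u \<open>\<zeta> > 0\<close>] by metis
    have "(G has_derivative (\<lambda>h. h *\<^sub>R (A (pt u 0) ** G u))) (at u)"
      using G(2)[OF u] by (simp add: has_vector_derivative_def)
    then obtain d2 where d2: "d2 > 0"
      "\<And>y. norm (y - u) < d2 \<Longrightarrow> norm (G y - G u - (y - u) *\<^sub>R (A (pt u 0) ** G u)) \<le> \<eta> * norm (y - u)"
      using \<open>\<eta> > 0\<close> unfolding has_derivative_at_alt by metis
    \<comment> \<open>\<open>\<bar>h\<bar> \<le> \<zeta> / (\<zeta> + L)\<close> makes the increment of \<open>B\<close> itself at most \<open>\<zeta>\<close>\<close>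
    define d where "d = Min {d1, d2, u - c1, c2 - u, \<zeta> / (\<zeta> + L)}"
    have d: "d > 0" "d \<le> d1" "d \<le> d2" "d \<le> u - c1" "d \<le> c2 - u" "d \<le> \<zeta> / (\<zeta> + L)"
      using d1(1) d2(1) c \<open>\<zeta> > 0\<close> L(1) by (auto simp: d_def)
    have "u + h \<in> ?I \<and> norm (F (u + h) s - F u s - h *\<^sub>R (A (pt u s) ** F u s)) \<le> \<epsilon> * \<bar>h\<bar>"
      if h: "\<bar>h\<bar> < d" and s: "\<bar>s\<bar> \<le> V" for h s
    proof
      show uh: "u + h \<in> ?I" using d1(2)[of h s] h s d by auto
      define Z where "Z = (\<lambda>s. F (u + h) s - (F u s + h *\<^sub>R (A (pt u s) ** F u s)))"
      define Z' where "Z' = (\<lambda>s. B (pt (u + h) s) ** F (u + h) s - (B (pt u s) ** F u s +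
          h *\<^sub>R (A (pt u s) ** (B (pt u s) ** F u s) + partial 2 A (pt u s) ** F u s)))"
      have "norm (Z s) \<le> 2 * (\<eta> * \<bar>h\<bar>) * exp ((2 * M + 1) * \<bar>s\<bar>)"
      proof (rule gronwall_estimate)
        fix r assume "r \<in> closed_segment 0 s"
        then have r: "\<bar>r\<bar> \<le> V" using s by (auto simp: closed_segment_eq_real_ivl split: if_splits)
        have "A differentiable at (pt u r)"
          using dA u by (auto simp: differentiable_on_eq_differentiable_at)
        then show "(Z has_vector_derivative Z' r) (at r)" unfolding Z_def Z'_def
          by (intro has_vector_derivative_diff has_vector_derivative_add F u uh
              bounded_linear.has_vector_derivative[OF bounded_linear_scaleR_right]
              mm.has_vector_derivative has_vector_derivative_partial_v)
        let ?B = "B (pt u r)" and ?Bh = "B (pt (u + h) r)" and ?A = "A (pt u r)" and ?F = "F u r"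
          and ?Bu = "partial 1 B (pt u r)"
        \<comment> \<open>here compatibility enters: it trades \<open>A\<^sub>v\<close> for \<open>B\<^sub>u\<close>, which cancels the increment of \<open>B\<close> to first order\<close>
        have "?A ** (?B ** ?F) + partial 2 A (pt u r) ** ?F = ?Bu ** ?F + ?B ** (?A ** ?F)"
          using arg_cong[OF compat[of "pt u r"], of "\<lambda>m. m ** ?F"] u
          by (simp add: mm.add_left matrix_mul_assoc add.commute)
        then have "Z' r = ?Bh ** F (u + h) r - (?B ** ?F + h *\<^sub>R (?Bu ** ?F + ?B ** (?A ** ?F)))"
          by (simp add: Z'_def)
        also have "\<dots> = ?Bh ** Z r + ((?Bh - ?B - h *\<^sub>R ?Bu) ** ?F + h *\<^sub>R ((?Bh - ?B) ** (?A ** ?F)))"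
          by (simp add: Z_def mm.diff_left mm.diff_right mm.add_right mm.scaleR_left mm.scaleR_right
              scaleR_diff_right scaleR_add_right)
        finally have "Z' r = ?Bh ** Z r + ((?Bh - ?B - h *\<^sub>R ?Bu) ** ?F + h *\<^sub>R ((?Bh - ?B) ** (?A ** ?F)))" .
        moreover have "norm (?Bh ** Z r) \<le> M * norm (Z r)"
          by (rule M(2)) (use h d r in \<open>simp add: R abs_less_iff\<close>)
        moreover have "norm ((?Bh - ?B - h *\<^sub>R ?Bu) ** ?F) \<le> (\<zeta> * \<bar>h\<bar>) * N * K"
        proof -
          have "norm (?Bh - ?B - h *\<^sub>R ?Bu) \<le> \<zeta> * \<bar>h\<bar>" using d1(2)[of h r] h r d by auto
          then have "norm (?Bh - ?B - h *\<^sub>R ?Bu) * norm ?F * K \<le> (\<zeta> * \<bar>h\<bar>) * N * K"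
            using N(1) N(2)[OF r] K(1) \<open>\<zeta> > 0\<close> by (intro mult_mono mult_right_mono) auto
          with K(2) show ?thesis by (rule order_trans)
        qed
        moreover have "norm (h *\<^sub>R ((?Bh - ?B) ** (?A ** ?F))) \<le> \<bar>h\<bar> * (\<zeta> * N * K)"
        proof -
          have "norm (?Bh - ?B - h *\<^sub>R ?Bu) \<le> \<zeta> * \<bar>h\<bar>" using d1(2)[of h r] h r d by auto
          moreover have "norm (h *\<^sub>R ?Bu) \<le> L * \<bar>h\<bar>"
            using L(2)[of "pt u r"] c r by (simp add: R mult.commute[of L] mult_left_mono)
          ultimately have "norm (?Bh - ?B) \<le> (\<zeta> + L) * \<bar>h\<bar>"
            using norm_triangle_sub[of "?Bh - ?B" "h *\<^sub>R ?Bu"] by (simp add: algebra_simps)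
          also have "\<dots> \<le> (\<zeta> + L) * (\<zeta> / (\<zeta> + L))"
            using h d L(1) \<open>\<zeta> > 0\<close> by (intro mult_left_mono) auto
          also have "\<dots> = \<zeta>" using L(1) \<open>\<zeta> > 0\<close> by simp
          finally have "norm (?Bh - ?B) * norm (?A ** ?F) * K \<le> \<zeta> * N * K"
            using N(1) N(3)[OF r] K(1) \<open>\<zeta> > 0\<close> by (intro mult_mono mult_right_mono) auto
          with K(2) have "norm ((?Bh - ?B) ** (?A ** ?F)) \<le> \<zeta> * N * K" by (rule order_trans)
          then show ?thesis by (simp add: mult_left_mono)
        qed
        moreover have "(\<zeta> * \<bar>h\<bar>) * N * K + \<bar>h\<bar> * (\<zeta> * N * K) = \<eta> * \<bar>h\<bar>"
          using N(1) K(1) by (simp add: \<zeta>_def)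
        ultimately show "norm (Z' r) \<le> M * norm (Z r) + \<eta> * \<bar>h\<bar>"
          by (smt (verit, best) norm_triangle_ineq)
      next
        have "norm (u + h - u) < d2" using h d by simp
        from d2(2)[OF this] show "norm (Z 0) \<le> \<eta> * \<bar>h\<bar>"
          by (simp add: Z_def F0[OF u] F0[OF uh] diff_diff_eq)
      qed (use M in simp)
      also have "\<dots> \<le> 2 * (\<eta> * \<bar>h\<bar>) * exp ((2 * M + 1) * V)"
        using M(1) s \<open>\<eta> > 0\<close> by (intro mult_left_mono) (auto intro!: mult_left_mono)
      also have "\<dots> = \<epsilon> * \<bar>h\<bar>" by (simp add: \<eta>_def)
      finally show "norm (F (u + h) s - F u s - h *\<^sub>R (A (pt u s) ** F u s)) \<le> \<epsilon> * \<bar>h\<bar>"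
        by (simp add: Z_def diff_diff_eq)
    qed
    then show ?thesis using d(1) by blast
  qed

  define X where "X = (\<lambda>p :: real^2. F (p $ 1) (p $ 2))"
  show thesis
  proof (rule that)
    show "X (pt t0 0) = X0" using F0[OF t0] G by (simp add: X_def)
    fix p assume p: "p \<in> strip a b"
    define u v where "u = p $ 1" and "v = p $ 2"
    have pt: "p = pt u v" and u: "u \<in> ?I" using p by (simp_all add: u_def v_def strip_nth)
    define \<phi> where "\<phi> = (\<lambda>s. A (pt u s) ** F u s)"
    have "isCont \<phi> v"
      using mm.continuous_on[OF contA[OF u] contF[OF u], of UNIV]
      by (simp add: \<phi>_def continuous_on_eq_continuous_at)
    have Fv: "(F u has_derivative (\<lambda>k. k *\<^sub>R (B p ** X p))) (at v)"
      using F[OF u, of v] by (simp add: has_vector_derivative_def X_def pt)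
    show "(X has_derivative (\<lambda>h. h $ 1 *\<^sub>R (A p ** X p) + h $ 2 *\<^sub>R (B p ** X p))) (at p)"
      unfolding has_derivative_at_alt
    proof (intro conjI allI impI)
      show "bounded_linear (\<lambda>h. h $ 1 *\<^sub>R (A p ** X p) + h $ 2 *\<^sub>R (B p ** X p))"
        by (intro bounded_linear_add bounded_linear_scaleR_const bounded_linear_vec_nth)
      fix e :: real assume "e > 0"
      then have e3: "e / 3 > 0" by simp
      obtain d1 where d1: "d1 > 0" "\<And>h s. \<bar>h\<bar> < d1 \<Longrightarrow> \<bar>s\<bar> \<le> \<bar>v\<bar> + 1 \<Longrightarrow>
          norm (F (u + h) s - F u s - h *\<^sub>R \<phi> s) \<le> e / 3 * \<bar>h\<bar>"
        using key[OF u e3, of "\<bar>v\<bar> + 1"] unfolding \<phi>_def by (auto simp: add_nonneg_pos)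
      obtain d2 where d2: "d2 > 0" "\<And>y. norm (y - v) < d2 \<Longrightarrow>
          norm (F u y - F u v - (y - v) *\<^sub>R (B p ** X p)) \<le> e / 3 * norm (y - v)"
        using Fv e3 unfolding has_derivative_at_alt by metis
      obtain d3 where d3: "d3 > 0" "\<And>y. norm (y - v) < d3 \<Longrightarrow> norm (\<phi> y - \<phi> v) < e / 3"
        using \<open>isCont \<phi> v\<close> e3 unfolding continuous_at_eps_delta dist_norm by metis
      define d where "d = Min {d1, d2, d3, 1}"
      have d: "d > 0" "d \<le> d1" "d \<le> d2" "d \<le> d3" "d \<le> 1" using d1(1) d2(1) d3(1) by (auto simp: d_def)
      have "norm (X y - X p - ((y - p) $ 1 *\<^sub>R (A p ** X p) + (y - p) $ 2 *\<^sub>R (B p ** X p))) \<le> e * norm (y - p)"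
        if y: "norm (y - p) < d" for y
      proof -
        define h k where "h = (y - p) $ 1" and "k = (y - p) $ 2"
        have hk: "\<bar>h\<bar> \<le> norm (y - p)" "\<bar>k\<bar> \<le> norm (y - p)"
          using component_le_norm_cart[of "y - p"] by (simp_all add: h_def k_def)
        have Xy: "X y = F (u + h) (v + k)" by (simp add: X_def u_def v_def h_def k_def)
        have Xp: "X p = F u v" "A p ** X p = \<phi> v" by (simp_all add: X_def u_def v_def \<phi>_def)
        have "\<bar>v + k\<bar> \<le> \<bar>v\<bar> + 1" using hk y d by linarith
        then have 1: "norm (F (u + h) (v + k) - F u (v + k) - h *\<^sub>R \<phi> (v + k)) \<le> e / 3 * \<bar>h\<bar>"
          using d1(2) hk y d by auto
        have 2: "norm (F u (v + k) - F u v - k *\<^sub>R (B p ** X p)) \<le> e / 3 * \<bar>k\<bar>"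
          using d2(2)[of "v + k"] hk y d by auto
        have "norm (\<phi> (v + k) - \<phi> v) \<le> e / 3" using d3(2)[of "v + k"] hk y d by (simp add: less_imp_le)
        then have "\<bar>h\<bar> * norm (\<phi> (v + k) - \<phi> v) \<le> \<bar>h\<bar> * (e / 3)"
          by (intro mult_left_mono) auto
        then have 3: "norm (h *\<^sub>R (\<phi> (v + k) - \<phi> v)) \<le> e / 3 * \<bar>h\<bar>"
          by (simp add: mult.commute)
        have "X y - X p - (h *\<^sub>R (A p ** X p) + k *\<^sub>R (B p ** X p)) =
            (F (u + h) (v + k) - F u (v + k) - h *\<^sub>R \<phi> (v + k)) + (F u (v + k) - F u v - k *\<^sub>R (B p ** X p))
            + h *\<^sub>R (\<phi> (v + k) - \<phi> v)"
          unfolding Xp(2) by (simp add: Xy Xp(1) scaleR_diff_right)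
        then have "norm (X y - X p - (h *\<^sub>R (A p ** X p) + k *\<^sub>R (B p ** X p))) \<le>
            e / 3 * \<bar>h\<bar> + e / 3 * \<bar>k\<bar> + e / 3 * \<bar>h\<bar>"
          using 1 2 3 by (smt (verit, best) norm_triangle_ineq)
        also have "\<dots> \<le> e / 3 * norm (y - p) + e / 3 * norm (y - p) + e / 3 * norm (y - p)"
          using hk e3 by (intro add_mono mult_left_mono) auto
        finally show ?thesis by (simp add: h_def k_def)
      qed
      then show "\<exists>d>0. \<forall>y. norm (y - p) < d \<longrightarrow>
          norm (X y - X p - ((y - p) $ 1 *\<^sub>R (A p ** X p) + (y - p) $ 2 *\<^sub>R (B p ** X p))) \<le> e * norm (y - p)"
        using d(1) by blast
    qed
  qed
qed

section \<open>Calculus of continuously differentiable maps of the plane\<close>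

lemma partial_eq:
  assumes "(F has_derivative F') (at p)"
  shows "partial i F p = F' (axis i 1)"
  unfolding partial_def using frechet_derivative_at[OF assms] by simp

lemma has_derivative_frechet:
  assumes "F differentiable_on U" "open U" "p \<in> U"
  shows "(F has_derivative frechet_derivative F (at p)) (at p)"
  using assms by (auto simp: differentiable_on_eq_differentiable_at frechet_derivative_works)

lemma ck_on_SucI_has_derivative:
  assumes "open U" "\<And>p. p \<in> U \<Longrightarrow> (F has_derivative F' p) (at p)"
    and "\<And>i. ck_on k U (partial i F)"
  shows "ck_on (Suc k) U F"
  using assms by (auto simp: differentiable_on_eq_differentiable_at differentiable_def)

text \<open>Partial derivatives are total functions defined through a choice operator, so the locality of the
  derivative has to be transferred to the chosen map.\<close>

lemma partial_cong_open:
  assumes "open U" "p \<in> U" "\<And>q. q \<in> U \<Longrightarrow> F q = G q"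
  shows "partial i F p = partial i G p"
proof -
  have "(F has_derivative D) (at p) \<longleftrightarrow> (G has_derivative D) (at p)" for D
    using has_derivative_transform_within_open[of F D p UNIV U G]
      has_derivative_transform_within_open[of G D p UNIV U F] assms by auto
  then show ?thesis by (simp add: partial_def frechet_derivative_def)
qed

lemma ck_on_cong:
  assumes "open U" "\<And>q. q \<in> U \<Longrightarrow> F q = G q"
  shows "ck_on k U F \<longleftrightarrow> ck_on k U G"
  using assms(2)
proof (induction k arbitrary: F G)
  case 0
  then show ?case by (auto intro: continuous_on_cong[THEN iffD1, rotated -1])
next
  case (Suc k)
  have "F differentiable_on U \<longleftrightarrow> G differentiable_on U"
    using Suc.prems by (auto simp: differentiable_on_def intro: differentiable_transform_within[OF _ zero_less_one])
  moreover have "ck_on k U (partial i F) \<longleftrightarrow> ck_on k U (partial i G)" for i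
    by (rule Suc.IH) (rule partial_cong_open[OF assms(1) _ Suc.prems])
  ultimately show ?case by simp
qed

lemma ck_on_transfer:
  assumes "ck_on k U G" "open U" "\<And>q. q \<in> U \<Longrightarrow> F q = G q"
  shows "ck_on k U F"
  using ck_on_cong[OF assms(2), of F G k] assms by blast

lemma ck_on_SucD: "ck_on (Suc k) U F \<Longrightarrow> ck_on k U F"
proof (induction k arbitrary: F)
  case 0
  then show ?case by (auto intro: differentiable_imp_continuous_on)
next
  case (Suc k)
  from Suc.prems have "F differentiable_on U" "\<And>i. ck_on (Suc k) U (partial i F)" by simp_all
  with Suc.IH show ?case by simp
qed

lemma ck_on_const: "open U \<Longrightarrow> ck_on k U (\<lambda>p. c)"
proof (induction k arbitrary: c)
  case (Suc k)
  have "partial i (\<lambda>p. c) = (\<lambda>p. 0)" for i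
    by (rule ext) (simp add: partial_eq[OF has_derivative_const])
  then show ?case using Suc by simp
qed simp

lemma ck_on_bounded_linear:
  assumes "open U" "bounded_linear L" "ck_on k U F"
  shows "ck_on k U (\<lambda>p. L (F p))"
  using assms(3)
proof (induction k arbitrary: F)
  case 0
  then show ?case using assms(2) by (auto intro: bounded_linear.continuous_on)
next
  case (Suc k)
  have D: "((\<lambda>p. L (F p)) has_derivative (\<lambda>h. L (frechet_derivative F (at p) h))) (at p)" if "p \<in> U" for p
    using bounded_linear.has_derivative[OF assms(2)] has_derivative_frechet[of F U p] Suc.prems assms(1) that
    by simp
  have parts: "ck_on k U (\<lambda>p. L (partial i F p))" for i using Suc by simp
  have "ck_on k U (partial i (\<lambda>p. L (F p)))" for i
    by (rule ck_on_transfer[OF parts[of i] assms(1)]) (simp add: partial_eq[OF D], simp add: partial_def)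
  then show ?case using ck_on_SucI_has_derivative[OF assms(1) D] by blast
qed

lemma ck_on_add:
  assumes "open U" "ck_on k U F" "ck_on k U G"
  shows "ck_on k U (\<lambda>p. F p + G p)"
  using assms(2,3)
proof (induction k arbitrary: F G)
  case 0
  then show ?case by (auto intro: continuous_on_add)
next
  case (Suc k)
  have D: "((\<lambda>p. F p + G p) has_derivative
      (\<lambda>h. frechet_derivative F (at p) h + frechet_derivative G (at p) h)) (at p)" if "p \<in> U" for p
    by (rule has_derivative_add) (rule has_derivative_frechet[of _ U p], use Suc.prems assms(1) that in simp_all)+
  have parts: "ck_on k U (\<lambda>p. partial i F p + partial i G p)" for i using Suc by simp
  have "ck_on k U (partial i (\<lambda>p. F p + G p))" for i
    by (rule ck_on_transfer[OF parts[of i] assms(1)]) (simp add: partial_eq[OF D], simp add: partial_def)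
  then show ?case using ck_on_SucI_has_derivative[OF assms(1) D] by blast
qed

lemma ck_on_bilinear:
  assumes "open U" "bounded_bilinear mul" "ck_on k U F" "ck_on k U G"
  shows "ck_on k U (\<lambda>p. mul (F p) (G p))"
  using assms(3,4)
proof (induction k arbitrary: F G)
  case 0
  then show ?case using assms(2) by (auto intro: bounded_bilinear.continuous_on)
next
  case (Suc k)
  have D: "((\<lambda>p. mul (F p) (G p)) has_derivative
      (\<lambda>h. mul (F p) (frechet_derivative G (at p) h) + mul (frechet_derivative F (at p) h) (G p))) (at p)"
    if "p \<in> U" for p
    by (rule bounded_bilinear.FDERIV[OF assms(2)])
      (rule has_derivative_frechet[of _ U p], use Suc.prems assms(1) that in simp_all)+
  have parts: "ck_on k U (\<lambda>p. mul (F p) (partial i G p) + mul (partial i F p) (G p))" for i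
    using Suc.prems ck_on_SucD[OF Suc.prems(1)] ck_on_SucD[OF Suc.prems(2)]
    by (intro ck_on_add Suc.IH assms(1)) auto
  have "ck_on k U (partial i (\<lambda>p. mul (F p) (G p)))" for i
    by (rule ck_on_transfer[OF parts[of i] assms(1)]) (simp add: partial_eq[OF D], simp add: partial_def)
  then show ?case using ck_on_SucI_has_derivative[OF assms(1) D] by blast
qed

lemma has_derivative_nth_compose:
  assumes "(\<phi> has_real_derivative d) (at (p $ i))"
  shows "((\<lambda>p :: real^'n. \<phi> (p $ i)) has_derivative (\<lambda>h. h $ i * d)) (at p)"
  by (rule DERIV_compose_FDERIV[where f = \<phi> and g = "\<lambda>p. p $ i", OF assms])
    (rule bounded_linear_imp_has_derivative[OF bounded_linear_vec_nth])

lemma has_derivative_cos_v: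
  "((\<lambda>q :: real^2. cos (k * q $ 2)) has_derivative (\<lambda>h. h $ 2 * (- sin (k * p $ 2) * k))) (at p)"
  by (rule has_derivative_nth_compose[where \<phi> = "\<lambda>v. cos (k * v)"]) (auto intro!: derivative_eq_intros)

lemma has_derivative_sin_v:
  "((\<lambda>q :: real^2. sin (k * q $ 2)) has_derivative (\<lambda>h. h $ 2 * (cos (k * p $ 2) * k))) (at p)"
  by (rule has_derivative_nth_compose[where \<phi> = "\<lambda>v. sin (k * v)"]) (auto intro!: derivative_eq_intros)

lemma ck_on_Suc_nth_compose:
  fixes U :: "(real^2) set"
  assumes "open U" "\<And>p. p \<in> U \<Longrightarrow> (\<phi> has_real_derivative \<phi>' (p $ i)) (at (p $ i))"
    and "ck_on k U (\<lambda>p. \<phi>' (p $ i))"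
  shows "ck_on (Suc k) U (\<lambda>p. \<phi> (p $ i))"
proof (rule ck_on_SucI_has_derivative[OF assms(1)])
  note D = has_derivative_nth_compose[OF assms(2)]
  then show "((\<lambda>p. \<phi> (p $ i)) has_derivative (\<lambda>h. h $ i * \<phi>' (p $ i))) (at p)" if "p \<in> U" for p
    using that by blast
  fix j
  have "ck_on k U (\<lambda>p. (axis j 1 :: real^2) $ i * \<phi>' (p $ i))"
    by (intro ck_on_bilinear[OF assms(1) bounded_bilinear_mult] ck_on_const assms)
  then show "ck_on k U (partial j (\<lambda>p. \<phi> (p $ i)))"
    by (rule ck_on_transfer[OF _ assms(1)]) (simp add: partial_eq[OF D])
qed

text \<open>Schwarz's argument: the second difference over a small square with corner \<open>p\<close> equals
  \<open>h\<^sup>2\<close> times either mixed derivative at some point of the square, by two applications of the mean value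
  theorem in either order.\<close>

lemma partial_commute_real:
  fixes g :: "real^2 \<Rightarrow> real"
  assumes "open U" "ck_on 2 U g" "p \<in> U"
  shows "partial 1 (partial 2 g) p = partial 2 (partial 1 g) p"
proof (rule ccontr)
  assume ne: "partial 1 (partial 2 g) p \<noteq> partial 2 (partial 1 g) p"
  define \<epsilon> where "\<epsilon> = \<bar>partial 1 (partial 2 g) p - partial 2 (partial 1 g) p\<bar> / 2"
  have "\<epsilon> > 0" using ne by (simp add: \<epsilon>_def)
  have ck: "g differentiable_on U" "\<And>i. partial i g differentiable_on U"
    "\<And>i j. continuous_on U (partial j (partial i g))"
    using assms(2) by (simp_all add: numeral_2_eq_2)
  have diff: "g differentiable at q" "partial i g differentiable at q" if "q \<in> U" for q i
    using ck(1,2) assms(1) that by (auto simp: differentiable_on_eq_differentiable_at)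
  have "isCont (partial 1 (partial 2 g)) p" "isCont (partial 2 (partial 1 g)) p"
    using ck(3) assms continuous_on_eq_continuous_at by blast+
  then obtain d1 d2 where d1: "d1 > 0" "\<And>q. dist q p < d1 \<Longrightarrow> dist (partial 1 (partial 2 g) q) (partial 1 (partial 2 g) p) < \<epsilon>"
    and d2: "d2 > 0" "\<And>q. dist q p < d2 \<Longrightarrow> dist (partial 2 (partial 1 g) q) (partial 2 (partial 1 g) p) < \<epsilon>"
    using \<open>\<epsilon> > 0\<close> unfolding continuous_at_eps_delta by metis
  obtain d3 where d3: "d3 > 0" "ball p d3 \<subseteq> U" using assms(1,3) open_contains_ball by metis
  define h where "h = min d1 (min d2 d3) / 3"
  have "h > 0" using d1 d2 d3 by (simp add: h_def)
  define u v where "u = p $ 1" and "v = p $ 2"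
  have near: "dist (pt s t) p < d1" "dist (pt s t) p < d2" "pt s t \<in> U"
    if "u \<le> s" "s \<le> u + h" "v \<le> t" "t \<le> v + h" for s t
  proof -
    have "pt s t - p = (s - u) *\<^sub>R axis 1 1 + (t - v) *\<^sub>R axis 2 1"
      by (simp add: vec_eq_iff forall_2 u_def v_def axis_def)
    then have "dist (pt s t) p \<le> \<bar>s - u\<bar> + \<bar>t - v\<bar>"
      using norm_triangle_ineq[of "(s - u) *\<^sub>R axis 1 1 :: real^2" "(t - v) *\<^sub>R axis 2 1"] by (simp add: dist_norm)
    also have "\<dots> \<le> 2 * h" using that by simp
    also have "\<dots> < min d1 (min d2 d3)" using \<open>h > 0\<close> unfolding h_def by linarith
    finally have lt: "dist (pt s t) p < min d1 (min d2 d3)" .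
    then show "dist (pt s t) p < d1" "dist (pt s t) p < d2" by simp_all
    show "pt s t \<in> U" using lt d3(2) by (auto simp: dist_commute)
  qed
  define \<Delta> where "\<Delta> = g (pt (u + h) (v + h)) - g (pt (u + h) v) - (g (pt u (v + h)) - g (pt u v))"
  have du: "((\<lambda>s. k (pt s t)) has_real_derivative partial 1 k (pt s t)) (at s)"
    if "k differentiable at (pt s t)" for k s t
    using has_vector_derivative_partial_u[OF that] by (simp add: has_real_derivative_iff_has_vector_derivative)
  have dv: "((\<lambda>t. k (pt s t)) has_real_derivative partial 2 k (pt s t)) (at t)"
    if "k differentiable at (pt s t)" for k s t
    using has_vector_derivative_partial_v[OF that] by (simp add: has_real_derivative_iff_has_vector_derivative)
  have "\<exists>z>u. z < u + h \<and> (g (pt (u + h) (v + h)) - g (pt (u + h) v)) - (g (pt u (v + h)) - g (pt u v))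
      = (u + h - u) * (partial 1 g (pt z (v + h)) - partial 1 g (pt z v))"
    by (rule MVT2[where f = "\<lambda>s. g (pt s (v + h)) - g (pt s v)"])
      (use \<open>h > 0\<close> in \<open>auto intro!: DERIV_diff du diff near\<close>)
  then obtain s where s: "u < s" "s < u + h" "\<Delta> = h * (partial 1 g (pt s (v + h)) - partial 1 g (pt s v))"
    by (auto simp: \<Delta>_def)
  have "\<exists>z>v. z < v + h \<and> partial 1 g (pt s (v + h)) - partial 1 g (pt s v) = (v + h - v) * partial 2 (partial 1 g) (pt s z)"
    by (rule MVT2[where f = "\<lambda>t. partial 1 g (pt s t)"])
      (use \<open>h > 0\<close> s in \<open>auto intro!: dv diff near\<close>)
  then obtain t where t: "v < t" "t < v + h" "\<Delta> = h * (h * partial 2 (partial 1 g) (pt s t))"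
    using s by auto
  have "\<exists>z>v. z < v + h \<and> (g (pt (u + h) (v + h)) - g (pt u (v + h))) - (g (pt (u + h) v) - g (pt u v))
      = (v + h - v) * (partial 2 g (pt (u + h) z) - partial 2 g (pt u z))"
    by (rule MVT2[where f = "\<lambda>t. g (pt (u + h) t) - g (pt u t)"])
      (use \<open>h > 0\<close> in \<open>auto intro!: DERIV_diff dv diff near\<close>)
  then obtain t' where t': "v < t'" "t' < v + h" "\<Delta> = h * (partial 2 g (pt (u + h) t') - partial 2 g (pt u t'))"
    by (auto simp: \<Delta>_def algebra_simps)
  have "\<exists>z>u. z < u + h \<and> partial 2 g (pt (u + h) t') - partial 2 g (pt u t') = (u + h - u) * partial 1 (partial 2 g) (pt z t')"
    by (rule MVT2[where f = "\<lambda>s. partial 2 g (pt s t')"])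
      (use \<open>h > 0\<close> t' in \<open>auto intro!: du diff near\<close>)
  then obtain s' where s': "u < s'" "s' < u + h" "\<Delta> = h * (h * partial 1 (partial 2 g) (pt s' t'))"
    using t' by auto
  have eq: "partial 2 (partial 1 g) (pt s t) = partial 1 (partial 2 g) (pt s' t')"
    using t(3) s'(3) \<open>h > 0\<close> by simp
  have "dist (partial 1 (partial 2 g) (pt s' t')) (partial 1 (partial 2 g) p) < \<epsilon>"
    by (rule d1(2)[OF near(1)]) (use s' t' in auto)
  moreover have "dist (partial 2 (partial 1 g) (pt s t)) (partial 2 (partial 1 g) p) < \<epsilon>"
    by (rule d2(2)[OF near(2)]) (use s t in auto)
  ultimately show False using eq by (simp add: \<epsilon>_def dist_real_def abs_if split: if_splits)
qed

lemma partial_bounded_linear: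
  assumes "bounded_linear L" "F differentiable at p"
  shows "partial i (\<lambda>q. L (F q)) p = L (partial i F p)"
  using partial_eq[OF bounded_linear.has_derivative[OF assms(1) assms(2)[unfolded frechet_derivative_works]], of i]
  by (simp add: partial_def)

lemma partial_commute:
  fixes F :: "real^2 \<Rightarrow> 'a::real_inner"
  assumes U: "open U" "p \<in> U" and F: "ck_on 2 U F"
  shows "partial 1 (partial 2 F) p = partial 2 (partial 1 F) p"
proof -
  have diff: "F differentiable at q" "partial i F differentiable at q" if "q \<in> U" for q i
    using F U(1) that by (auto simp: numeral_2_eq_2 differentiable_on_eq_differentiable_at)
  have "partial 1 (partial 2 F) p \<bullet> z = partial 2 (partial 1 F) p \<bullet> z" for z
  proof -
    note bl = bounded_linear_inner_left[of z]
    have "partial j (partial i (\<lambda>q. F q \<bullet> z)) p = partial j (partial i F) p \<bullet> z" for i j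
    proof -
      have "partial j (partial i (\<lambda>q. F q \<bullet> z)) p = partial j (\<lambda>q. partial i F q \<bullet> z) p"
        by (rule partial_cong_open[OF U]) (rule partial_bounded_linear[OF bl diff(1)])
      also have "\<dots> = partial j (partial i F) p \<bullet> z"
        by (rule partial_bounded_linear[OF bl diff(2)[OF U(2)]])
      finally show ?thesis .
    qed
    moreover have "partial 1 (partial 2 (\<lambda>q. F q \<bullet> z)) p = partial 2 (partial 1 (\<lambda>q. F q \<bullet> z)) p"
      by (rule partial_commute_real[OF U(1) ck_on_bounded_linear[OF U(1) bl F] U(2)])
    ultimately show ?thesis by simp
  qed
  then show ?thesis by (metis vector_eq_ldot inner_commute)
qed

section \<open>Twisted shape operators and revolution metrics\<close>

lemma bounded_bilinear_matrix_vector_mult: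
  "bounded_bilinear ((*v) :: real^'n^'m \<Rightarrow> real^'n \<Rightarrow> real^'m)"
  unfolding bilinear_conv_bounded_bilinear[symmetric] bilinear_def linear_iff
  by (auto simp: vec_eq_iff matrix_vector_mult_def algebra_simps sum.distrib sum_distrib_left)

definition mat2 :: "'a \<Rightarrow> 'a \<Rightarrow> 'a \<Rightarrow> 'a \<Rightarrow> 'a::zero^2^2" where
  "mat2 s t u v = vector [vector [s, t], vector [u, v]]"

lemma mat2_nth [simp]:
  "mat2 s t u v $ 1 $ 1 = s" "mat2 s t u v $ 1 $ 2 = t"
  "mat2 s t u v $ 2 $ 1 = u" "mat2 s t u v $ 2 $ 2 = v"
  by (simp_all add: mat2_def)

text \<open>Conjugation by a rotation fixes the trace part and turns the reflection \<open>diag(1,-1)\<close> by the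
  double angle.\<close>

lemma twisted_diag_eq:
  "twisted_diag \<alpha> lam1 lam2 p =
    (let h = (lam1 (p $ 1) + lam2 (p $ 1)) / 2; m = (lam1 (p $ 1) - lam2 (p $ 1)) / 2; x = 2 * \<alpha> (p $ 2)
     in mat2 (h + m * cos x) (- m * sin x) (- m * sin x) (h - m * cos x))"
proof -
  show ?thesis
    unfolding Let_def cos_double_cos
    by (simp add: vec_eq_iff forall_2 twisted_diag_def rot_def matrix_matrix_mult_def sum_2 sin_double
        sin_squared_eq power2_eq_square[symmetric] field_simps)
qed

text \<open>The connection of a conformally flat metric \<open>exp(2 \<phi>) (du\<^sup>2 + dv\<^sup>2)\<close> is
  \<open>D\<^sub>X Y = dY(X) + d\<phi>(X) Y + d\<phi>(Y) X - (X \<bullet> Y) grad \<phi>\<close>; here \<open>\<phi> = ln \<rho>\<close>, whose gradient is \<open>(\<rho>'/\<rho>, 0)\<close>.\<close>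

lemma levi_civita_revolution_metric:
  assumes "(\<rho> has_real_derivative \<rho>1) (at (p $ 1))" "\<rho> (p $ 1) \<noteq> 0"
  shows "levi_civita (revolution_metric \<rho>) X Y p = frechet_derivative Y (at p) (X p)
    + (\<rho>1 / \<rho> (p $ 1)) *\<^sub>R (X p $ 1 *\<^sub>R Y p + Y p $ 1 *\<^sub>R X p - (X p \<bullet> Y p) *\<^sub>R axis 1 1)"
proof -
  let ?g = "revolution_metric \<rho>" and ?r = "\<rho> (p $ 1)"
  have inv: "matrix_inv (?g p) = mat (1 / ?r\<^sup>2)"
  proof -
    have "mat x ** mat y = (mat (x * y) :: real^2^2)" for x y :: real
      by (simp add: vec_eq_iff forall_2 matrix_matrix_mult_def sum_2 mat_def)
    then have "?g p ** mat (1 / ?r\<^sup>2) = mat 1" "mat (1 / ?r\<^sup>2) ** ?g p = mat 1"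
      using assms(2) by (simp_all add: revolution_metric_def)
    note AB = this
    have X: "?g p ** matrix_inv (?g p) = mat 1 \<and> matrix_inv (?g p) ** ?g p = mat 1"
      unfolding matrix_inv_def
      by (rule someI[of "\<lambda>A'. ?g p ** A' = mat 1 \<and> A' ** ?g p = mat 1" "mat (1 / ?r\<^sup>2)"]) (use AB in blast)
    have "matrix_inv (?g p) = (matrix_inv (?g p) ** ?g p) ** mat (1 / ?r\<^sup>2)"
      unfolding matrix_mul_assoc[symmetric] AB(1) matrix_mul_rid ..
    then show ?thesis using X by (simp only: matrix_mul_lid)
  qed
  have "((\<lambda>u. (\<rho> u)\<^sup>2) has_real_derivative 2 * ?r * \<rho>1) (at (p $ 1))"
    by (auto intro!: derivative_eq_intros assms(1))
  from partial_eq[OF has_derivative_nth_compose[OF this]]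
  have p0: "partial i (\<lambda>q. (\<rho> (q $ 1))\<^sup>2) p = (if i = 1 then 2 * ?r * \<rho>1 else 0)" for i
    by (simp add: axis_def)
  have "partial i (\<lambda>q. 0) p = (0 :: real)" for i
    by (simp add: partial_eq[OF has_derivative_const])
  then have part: "partial i (\<lambda>q. ?g q $ l $ j) p = (if l = j \<and> i = 1 then 2 * ?r * \<rho>1 else 0)" for i l j
    using p0 by (cases "l = j") (simp_all add: revolution_metric_def mat_def)
  have chr: "christoffel ?g k i j p = \<rho>1 / ?r *
      ((if k = j \<and> i = 1 then 1 else 0) + (if k = i \<and> j = 1 then 1 else 0) - (if i = j \<and> k = 1 then 1 else 0))"
    for k i j
  proof -
    have "(\<Sum>l\<in>UNIV. mat (1 / ?r\<^sup>2) $ k $ l * T l) = 1 / ?r\<^sup>2 * T k" for T :: "2 \<Rightarrow> real"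
      by (simp add: mat_def if_distrib[of "\<lambda>x. x * _"] cong: if_cong)
    moreover have "?r * \<rho>1 / ?r\<^sup>2 = \<rho>1 / ?r" "\<rho>1 * ?r / ?r\<^sup>2 = \<rho>1 / ?r"
      using assms(2) by (simp_all add: power2_eq_square field_simps)
    ultimately show ?thesis
      unfolding christoffel_def inv part by (auto split: if_splits)
  qed
  show ?thesis
    by (simp add: chr levi_civita_def vec_eq_iff forall_2 sum_2 inner_vec_def axis_def algebra_simps)
qed

lemma frechet_derivative_eq: "(F has_derivative F') (at p) \<Longrightarrow> frechet_derivative F (at p) = F'"
  using frechet_derivative_at by fastforce

text \<open>With \<open>w = \<rho>'/\<rho>\<close> one has \<open>D\<^sub>v \<partial>\<^sub>v = - w \<partial>\<^sub>u\<close> and \<open>D\<^sub>u \<partial>\<^sub>v = w \<partial>\<^sub>v\<close>; differentiating once more, the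
  terms in \<open>w\<^sup>2\<close> cancel and \<open>R(\<partial>\<^sub>u, \<partial>\<^sub>v) \<partial>\<^sub>v = - w' \<partial>\<^sub>u\<close> remains.\<close>

lemma gauss_curvature_revolution_metric:
  assumes pos: "\<And>u. u \<in> einterval a b \<Longrightarrow> \<rho> u > 0"
    and d1: "\<And>u. u \<in> einterval a b \<Longrightarrow> (\<rho> has_real_derivative \<rho>1 u) (at u)"
    and d2: "\<And>u. u \<in> einterval a b \<Longrightarrow> (\<rho>1 has_real_derivative \<rho>2 u) (at u)"
    and p: "p \<in> strip a b"
  shows "gauss_curvature (revolution_metric \<rho>) p = ((\<rho>1 (p $ 1))\<^sup>2 - \<rho> (p $ 1) * \<rho>2 (p $ 1)) / \<rho> (p $ 1) ^ 4"
proof -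
  let ?g = "revolution_metric \<rho>"
  define u where "u = p $ 1"
  have u: "u \<in> einterval a b" using p by (simp add: u_def strip_nth)
  define w where "w = (\<lambda>u. \<rho>1 u / \<rho> u)"
  define w' where "w' = (\<rho>2 u * \<rho> u - \<rho>1 u * \<rho>1 u) / (\<rho> u * \<rho> u)"
  have dw: "(w has_real_derivative w') (at (p $ 1))"
    unfolding w_def w'_def u_def[symmetric]
    using DERIV_divide[OF d2[OF u] d1[OF u]] pos[OF u] by simp
  note lc = levi_civita_revolution_metric[OF d1[OF strip_nth]]
  have nz: "\<rho> (q $ 1) \<noteq> 0" if "q \<in> strip a b" for q using pos[OF strip_nth[OF that]] by simp
  have fc: "frechet_derivative (coord_field i) (at q) = (\<lambda>_. 0)" for i q
    unfolding coord_field_def by (rule frechet_derivative_eq) simp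
  have l22: "levi_civita ?g (coord_field 2) (coord_field 2) q = (- w (q $ 1)) *\<^sub>R axis 1 1" if "q \<in> strip a b" for q
    using lc[OF that nz[OF that]] by (simp add: fc coord_field_def w_def axis_def vec_eq_iff forall_2 inner_vec_def sum_2)
  have l12: "levi_civita ?g (coord_field 1) (coord_field 2) q = w (q $ 1) *\<^sub>R axis 2 1" if "q \<in> strip a b" for q
    using lc[OF that nz[OF that]] by (simp add: fc coord_field_def w_def axis_def vec_eq_iff forall_2 inner_vec_def sum_2)
  have D: "((\<lambda>q :: real^2. w (q $ 1)) has_derivative (\<lambda>h. h $ 1 * w')) (at p)"
    by (rule has_derivative_nth_compose[OF dw])
  have "((\<lambda>q. (- w (q $ 1)) *\<^sub>R (axis 1 1 :: real^2)) has_derivative (\<lambda>h. (- (h $ 1 * w')) *\<^sub>R axis 1 1)) (at p)"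
    by (intro has_derivative_scaleR_left has_derivative_minus D)
  then have "(levi_civita ?g (coord_field 2) (coord_field 2) has_derivative (\<lambda>h. (- (h $ 1 * w')) *\<^sub>R axis 1 1)) (at p)"
    by (rule has_derivative_transform_within_open[OF _ open_strip p]) (simp add: l22)
  note f22 = frechet_derivative_eq[OF this]
  have "((\<lambda>q. w (q $ 1) *\<^sub>R (axis 2 1 :: real^2)) has_derivative (\<lambda>h. (h $ 1 * w') *\<^sub>R axis 2 1)) (at p)"
    by (intro has_derivative_scaleR_left D)
  then have "(levi_civita ?g (coord_field 1) (coord_field 2) has_derivative (\<lambda>h. (h $ 1 * w') *\<^sub>R axis 2 1)) (at p)"
    by (rule has_derivative_transform_within_open[OF _ open_strip p]) (simp add: l12)
  note f12 = frechet_derivative_eq[OF this]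
  have "levi_civita ?g (coord_field 1) (levi_civita ?g (coord_field 2) (coord_field 2)) p
      - levi_civita ?g (coord_field 2) (levi_civita ?g (coord_field 1) (coord_field 2)) p = (- w') *\<^sub>R axis 1 1"
    unfolding lc[OF p nz[OF p], of "coord_field 1" "levi_civita ?g (coord_field 2) (coord_field 2)"]
      lc[OF p nz[OF p], of "coord_field 2" "levi_civita ?g (coord_field 1) (coord_field 2)"]
      f22 f12 l22[OF p] l12[OF p]
    by (simp add: coord_field_def w_def axis_def vec_eq_iff forall_2 inner_vec_def sum_2)
  then have "gauss_curvature ?g p = - w' * (\<rho> u)\<^sup>2 / ((\<rho> u)\<^sup>2 * (\<rho> u)\<^sup>2)"
    by (simp add: gauss_curvature_def revolution_metric_def coord_field_def u_def det_2 mat_def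
        matrix_vector_mult_def inner_vec_def sum_2 axis_def)
  also have "\<dots> = ((\<rho>1 u)\<^sup>2 - \<rho> u * \<rho>2 u) / \<rho> u ^ 4"
    using pos[OF u] by (simp add: w'_def field_simps power2_eq_square power4_eq_xxxx)
  finally show ?thesis by (simp add: u_def)
qed

section \<open>The Gauss and Codazzi equations of a solution of the profile equation\<close>

locale cmc_profile =
  fixes u1 u2 :: ereal and H a b :: real and \<rho> \<rho>1 \<rho>2 :: "real \<Rightarrow> real"
  assumes pos: "u \<in> einterval u1 u2 \<Longrightarrow> \<rho> u > 0"
    and d1: "u \<in> einterval u1 u2 \<Longrightarrow> (\<rho> has_real_derivative \<rho>1 u) (at u)"
    and d2: "u \<in> einterval u1 u2 \<Longrightarrow> (\<rho>1 has_real_derivative \<rho>2 u) (at u)"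
    and profile: "u \<in> einterval u1 u2 \<Longrightarrow>
      (\<rho>1 u)\<^sup>2 - \<rho> u * \<rho>2 u = 1/4 * H\<^sup>2 * \<rho> u ^ 4 - b\<^sup>2 * exp (4 * a * u)"
begin

text \<open>Half the difference of the principal curvatures.\<close>

definition \<mu> :: "real \<Rightarrow> real" where
  "\<mu> u = b * (exp (2 * a * u) / (\<rho> u)\<^sup>2)"

definition shape :: endo_field where
  "shape p = mat2 (H / 2 + \<mu> (p $ 1) * cos (2 * a * p $ 2)) (- \<mu> (p $ 1) * sin (2 * a * p $ 2))
     (- \<mu> (p $ 1) * sin (2 * a * p $ 2)) (H / 2 - \<mu> (p $ 1) * cos (2 * a * p $ 2))"

text \<open>The logarithmic derivative of the conformal factor, through which all Christoffel symbols are
  expressed.\<close>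

definition w :: "real \<Rightarrow> real" where
  "w u = \<rho>1 u / \<rho> u"

text \<open>This is \<open>(\<rho>\<^sup>2 \<mu>)' = 2 a \<rho>\<^sup>2 \<mu>\<close>, the scalar form of the Codazzi equations.\<close>

lemma has_derivative_\<mu>:
  assumes "u \<in> einterval u1 u2"
  shows "(\<mu> has_real_derivative 2 * (a - w u) * \<mu> u) (at u)"
proof -
  have e: "((\<lambda>u. exp (2 * a * u)) has_real_derivative exp (2 * a * u) * (2 * a)) (at u)"
    by (auto intro!: derivative_eq_intros)
  have r: "((\<lambda>u. (\<rho> u)\<^sup>2) has_real_derivative 2 * \<rho> u * \<rho>1 u) (at u)"
    by (auto intro!: derivative_eq_intros d1[OF assms])
  have D: "(\<mu> has_real_derivative b * ((exp (2 * a * u) * (2 * a) * (\<rho> u)\<^sup>2 - exp (2 * a * u) * (2 * \<rho> u * \<rho>1 u))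
      / ((\<rho> u)\<^sup>2 * (\<rho> u)\<^sup>2))) (at u)"
    unfolding \<mu>_def[abs_def] using pos[OF assms] by (intro DERIV_cmult DERIV_divide e r) simp
  have eq: "b * ((E * (2 * a) * r\<^sup>2 - E * (2 * r * r')) / (r\<^sup>2 * r\<^sup>2)) = 2 * (a - r' / r) * (b * (E / r\<^sup>2))"
    if "r \<noteq> 0" for E r r'
    using that by (simp add: field_simps power2_eq_square)
  have "\<rho> u \<noteq> 0" using pos[OF assms] by simp
  from D[unfolded eq[OF this]] show ?thesis unfolding w_def \<mu>_def .
qed

text \<open>The profile equation, rewritten as the Gauss equation \<open>- w'/\<rho>\<^sup>2 = H\<^sup>2/4 - \<mu>\<^sup>2\<close>.\<close>

lemma has_derivative_w:
  assumes "u \<in> einterval u1 u2"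
  shows "(w has_real_derivative (\<rho> u)\<^sup>2 * ((\<mu> u)\<^sup>2 - H\<^sup>2 / 4)) (at u)"
proof -
  have "(w has_real_derivative (\<rho>2 u * \<rho> u - \<rho>1 u * \<rho>1 u) / (\<rho> u * \<rho> u)) (at u)"
    unfolding w_def[abs_def] using DERIV_divide[OF d2[OF assms] d1[OF assms]] pos[OF assms] by simp
  also have "(\<rho>2 u * \<rho> u - \<rho>1 u * \<rho>1 u) / (\<rho> u * \<rho> u) = (b\<^sup>2 * exp (4 * a * u) - 1/4 * H\<^sup>2 * \<rho> u ^ 4) / (\<rho> u)\<^sup>2"
    using profile[OF assms] by (simp add: power2_eq_square algebra_simps)
  also have "exp (4 * a * u) = (exp (2 * a * u))\<^sup>2"
    by (simp add: power2_eq_square exp_add[symmetric])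
  also have "(b\<^sup>2 * (exp (2 * a * u))\<^sup>2 - 1/4 * H\<^sup>2 * \<rho> u ^ 4) / (\<rho> u)\<^sup>2 = (\<rho> u)\<^sup>2 * ((\<mu> u)\<^sup>2 - H\<^sup>2 / 4)"
    using pos[OF assms] by (simp add: \<mu>_def field_simps power2_eq_square power4_eq_xxxx)
  finally show ?thesis .
qed

lemma twisted_diag_eq_shape:
  assumes "p \<in> strip u1 u2"
    and "\<forall>u\<in>einterval u1 u2. lam1 u = H / 2 + b * (exp (2 * a * u) / (\<rho> u)\<^sup>2)"
    and "\<forall>u\<in>einterval u1 u2. lam2 u = H / 2 - b * (exp (2 * a * u) / (\<rho> u)\<^sup>2)"
  shows "twisted_diag (\<lambda>v. a * v) lam1 lam2 p = shape p"
  using assms(2,3) strip_nth[OF assms(1)]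
  by (simp add: twisted_diag_eq shape_def \<mu>_def Let_def mult.assoc)

lemma gauss_equation_shape:
  assumes S: "\<And>p. p \<in> strip u1 u2 \<Longrightarrow> S p = shape p"
  shows "gauss_equation (strip u1 u2) (revolution_metric \<rho>) S"
  unfolding gauss_equation_def
proof
  fix p assume p: "p \<in> strip u1 u2"
  let ?u = "p $ 1" and ?x = "2 * a * p $ 2"
  have u: "?u \<in> einterval u1 u2" using p by (rule strip_nth)
  have "gauss_curvature (revolution_metric \<rho>) p = (1/4 * H\<^sup>2 * \<rho> ?u ^ 4 - b\<^sup>2 * exp (4 * a * ?u)) / \<rho> ?u ^ 4"
    using gauss_curvature_revolution_metric[OF pos d1 d2 p] profile[OF u] by simp
  also have "exp (4 * a * ?u) = (exp (2 * a * ?u))\<^sup>2"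
    by (simp add: power2_eq_square exp_add[symmetric])
  also have "(1/4 * H\<^sup>2 * \<rho> ?u ^ 4 - b\<^sup>2 * (exp (2 * a * ?u))\<^sup>2) / \<rho> ?u ^ 4 = H\<^sup>2 / 4 - (\<mu> ?u)\<^sup>2"
    using pos[OF u] by (simp add: \<mu>_def field_simps power2_eq_square power4_eq_xxxx)
  also have "\<dots> = H\<^sup>2 / 4 - (\<mu> ?u)\<^sup>2 * ((sin ?x)\<^sup>2 + (cos ?x)\<^sup>2)" by (simp only: sin_cos_squared_add mult_1_right)
  also have "\<dots> = det (S p)"
  proof -
    have "H\<^sup>2 / 4 - m\<^sup>2 * (s\<^sup>2 + c\<^sup>2) = (H / 2 + m * c) * (H / 2 - m * c) - (- m * s) * (- m * s)" for m s c
      by (simp add: power2_eq_square field_simps)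
    then show ?thesis unfolding S[OF p] shape_def det_2 mat2_nth by blast
  qed
  finally show "gauss_curvature (revolution_metric \<rho>) p = det (S p)" .
qed

text \<open>The equation is tensorial: the product rule removes the derivatives of the fields \<open>X\<close> and \<open>Y\<close>,
  and \<open>(D\<^sub>X S) Y - (D\<^sub>Y S) X\<close> is the determinant of \<open>(X, Y)\<close> times a vector that vanishes by the formulas for
  \<open>\<mu>\<^sub>u\<close> and for the rotation of the reflection part in \<open>v\<close>.\<close>

lemma codazzi_equations_shape:
  assumes S: "\<And>p. p \<in> strip u1 u2 \<Longrightarrow> S p = shape p"
  shows "codazzi_equations (strip u1 u2) (revolution_metric \<rho>) S"
  unfolding codazzi_equations_def
proof (intro ballI allI impI)
  fix p :: "real^2" and X Y :: vec_field
  assume p: "p \<in> strip u1 u2" and X: "X differentiable (at p)" and Y: "Y differentiable (at p)"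
  let ?u = "p $ 1"
  have u: "?u \<in> einterval u1 u2" using p by (rule strip_nth)
  define c s where "c = cos (2 * a * p $ 2)" and "s = sin (2 * a * p $ 2)"
  define m m' where "m = \<mu> ?u" and "m' = 2 * (a - w ?u) * m"
  define J1 J2 :: "real^2^2" where "J1 = mat2 1 0 0 (-1)" and "J2 = mat2 0 (-1) (-1) 0"
  \<comment> \<open>constant matrices with scalar coefficients, so that the scalar derivative rules suffice\<close>
  have shape: "shape q = mat (H / 2) + ((\<mu> (q $ 1) * cos (2 * a * q $ 2)) *\<^sub>R J1 + (\<mu> (q $ 1) * sin (2 * a * q $ 2)) *\<^sub>R J2)" for q
    by (simp add: shape_def J1_def J2_def vec_eq_iff forall_2 mat_def)
  define S' where "S' = (\<lambda>h :: real^2. (h $ 1 * m' * c - h $ 2 * 2 * a * m * s) *\<^sub>R J1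
      + (h $ 1 * m' * s + h $ 2 * 2 * a * m * c) *\<^sub>R J2)"
  have dm: "((\<lambda>q :: real^2. \<mu> (q $ 1)) has_derivative (\<lambda>h. h $ 1 * m')) (at p)"
    using has_derivative_nth_compose[OF has_derivative_\<mu>[OF u]] by (simp add: m_def m'_def)
  have dc: "((\<lambda>q :: real^2. cos (2 * a * q $ 2)) has_derivative (\<lambda>h. h $ 2 * (- s * (2 * a)))) (at p)"
    unfolding s_def by (rule has_derivative_cos_v)
  have ds: "((\<lambda>q :: real^2. sin (2 * a * q $ 2)) has_derivative (\<lambda>h. h $ 2 * (c * (2 * a)))) (at p)"
    unfolding c_def by (rule has_derivative_sin_v)
  have "(shape has_derivative S') (at p)"
  proof -
    have "((\<lambda>q. mat (H / 2) + ((\<mu> (q $ 1) * cos (2 * a * q $ 2)) *\<^sub>R J1 + (\<mu> (q $ 1) * sin (2 * a * q $ 2)) *\<^sub>R J2))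
      has_derivative (\<lambda>h. 0 + ((\<mu> (p $ 1) * (h $ 2 * (- s * (2 * a))) + h $ 1 * m' * cos (2 * a * p $ 2)) *\<^sub>R J1 +
        (\<mu> (p $ 1) * (h $ 2 * (c * (2 * a))) + h $ 1 * m' * sin (2 * a * p $ 2)) *\<^sub>R J2))) (at p)"
      by (intro has_derivative_add has_derivative_const has_derivative_scaleR_left has_derivative_mult dm dc ds)
    then show ?thesis
      unfolding shape[abs_def]
      by (rule has_derivative_eq_rhs)
        (simp add: S'_def fun_eq_iff c_def s_def m_def algebra_simps)
  qed
  then have dS: "(S has_derivative S') (at p)"
    by (rule has_derivative_transform_within_open[OF _ open_strip p]) (simp add: S)
  have prod: "frechet_derivative (\<lambda>q. S q *v Z q) (at p) h = S p *v frechet_derivative Z (at p) h + S' h *v Z p"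
    if "Z differentiable (at p)" for Z h
    by (subst frechet_derivative_eq[OF bounded_bilinear.FDERIV[OF bounded_bilinear_matrix_vector_mult dS
            that[unfolded frechet_derivative_works]]]) simp
  show "cov_deriv_endo (revolution_metric \<rho>) S X Y p = cov_deriv_endo (revolution_metric \<rho>) S Y X p"
    unfolding cov_deriv_endo_def levi_civita_revolution_metric[OF d1[OF u] less_imp_neq[OF pos[OF u], symmetric]]
      prod[OF X] prod[OF Y] S[OF p] w_def[symmetric] shape_def c_def[symmetric] s_def[symmetric] m_def[symmetric]
      S'_def J1_def J2_def m'_def
    by (simp add: vec_eq_iff forall_2 matrix_vector_mult_def sum_2 inner_vec_def axis_def) (simp add: algebra_simps)
qed

end

section \<open>The surface belonging to a solution of the profile equation\<close>

lemma convex_einterval: "convex (einterval a b)"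
proof -
  have "is_interval (einterval a b)"
    unfolding is_interval_1
  proof (intro ballI allI impI)
    fix x y z assume "x \<in> einterval a b" "y \<in> einterval a b" "x \<le> z \<and> z \<le> y"
    moreover from this have "ereal x \<le> ereal z" "ereal z \<le> ereal y" by simp_all
    ultimately show "z \<in> einterval a b" unfolding einterval_iff by (meson le_less_trans less_le_trans)
  qed
  then show ?thesis by (rule is_interval_convex)
qed

lemma convex_strip: "convex (strip a b)"
proof -
  have "strip a b = (\<lambda>p. p $ 1) -` einterval a b" by (auto simp: strip_def)
  then show ?thesis
    using convex_linear_vimage[OF bounded_linear.linear[OF bounded_linear_vec_nth] convex_einterval] by simp
qed

lemma constant_on_strip:
  fixes g :: "real^2 \<Rightarrow> 'a::real_normed_vector"
  assumes "\<And>p. p \<in> strip a b \<Longrightarrow> (g has_derivative (\<lambda>h. 0)) (at p)" "p \<in> strip a b" "q \<in> strip a b"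
  shows "g p = g q"
  using has_derivative_zero_constant[OF convex_strip, of a b g] assms has_derivative_at_withinI by metis

lemma jacobian_nth: "jacobian f (at p) $ k $ i = partial i f p $ k"
  by (simp add: jacobian_def matrix_def partial_def)

lemma first_fundamental_form_nth: "first_fundamental_form f p $ i $ j = partial i f p \<bullet> partial j f p"
  by (simp add: first_fundamental_form_def matrix_matrix_mult_def transpose_def jacobian_nth inner_vec_def)

text \<open>In isothermal coordinates the differential of \<open>f\<close> is injective (its Gram matrix is a non-zero
  multiple of the identity), hence the Weingarten equation determines the shape operator.\<close>

lemma shape_operator_eqI:
  assumes ff: "first_fundamental_form f p = mat c" "c \<noteq> 0"
    and S: "\<And>i. partial i (gauss_map f) p = - (S $ 1 $ i *\<^sub>R partial 1 f p + S $ 2 $ i *\<^sub>R partial 2 f p)"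
  shows "shape_operator f p = S"
proof -
  let ?J = "jacobian f (at p)" and ?N = "jacobian (gauss_map f) (at p)"
  have sol: "?J ** S = - ?N"
    by (simp add: vec_eq_iff matrix_matrix_mult_def sum_2 jacobian_nth S mult.commute)
  have "T = S" if "?J ** T = - ?N" for T
  proof -
    have "transpose ?J ** (?J ** T) = transpose ?J ** (?J ** S)" using that sol by simp
    then have "mat c ** T = mat c ** S" using ff by (simp add: matrix_mul_assoc first_fundamental_form_def)
    moreover have "(mat c ** M) $ i $ j = c * M $ i $ j" for M :: "real^2^2" and i j
      using exhaust_2[of i] by (auto simp: matrix_matrix_mult_def sum_2 mat_def)
    ultimately have "c * T $ i $ j = c * S $ i $ j" for i j by metis
    then show ?thesis using ff(2) by (simp add: vec_eq_iff)
  qed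
  then show ?thesis unfolding shape_operator_def using sol by (intro the_equality)
qed

text \<open>The general coefficient matrix for the derivative of the rows \<open>e\<^sub>1, e\<^sub>2, n, f\<close>: a skew-symmetric
  \<open>3 \<times> 3\<close> block for the orthonormal frame and a last row that expresses \<open>df\<close> in tangent vectors.\<close>

definition frame_matrix :: "real \<Rightarrow> real \<Rightarrow> real \<Rightarrow> real \<Rightarrow> real \<Rightarrow> real^4^4" where
  "frame_matrix \<omega> p q s t = vector [vector [0, \<omega>, p, 0], vector [- \<omega>, 0, q, 0], vector [- p, - q, 0, 0], vector [s, t, 0, 0]]"

lemma vector_4:
  "(vector [x1, x2, x3, x4] :: 'a::zero^4) $ 1 = x1" "(vector [x1, x2, x3, x4] :: 'a^4) $ 2 = x2"
  "(vector [x1, x2, x3, x4] :: 'a^4) $ 3 = x3" "(vector [x1, x2, x3, x4] :: 'a^4) $ 4 = x4"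
  by (simp_all add: vector_def)

lemma frame_matrix_mult_nth:
  fixes X :: "real^3^4"
  shows "(frame_matrix \<omega> p q s t ** X) $ 1 = \<omega> *\<^sub>R X $ 2 + p *\<^sub>R X $ 3"
    "(frame_matrix \<omega> p q s t ** X) $ 2 = - \<omega> *\<^sub>R X $ 1 + q *\<^sub>R X $ 3"
    "(frame_matrix \<omega> p q s t ** X) $ 3 = - p *\<^sub>R X $ 1 - q *\<^sub>R X $ 2"
    "(frame_matrix \<omega> p q s t ** X) $ 4 = s *\<^sub>R X $ 1 + t *\<^sub>R X $ 2"
  by (simp_all add: frame_matrix_def vec_eq_iff matrix_matrix_mult_def sum_4 vector_4)

text \<open>Differentiation and regularity of \<open>frame_matrix\<close> reduce to its five scalar arguments.\<close>

lemma frame_matrix_linear: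
  "frame_matrix \<omega> p q s t = \<omega> *\<^sub>R frame_matrix 1 0 0 0 0 + (p *\<^sub>R frame_matrix 0 1 0 0 0 +
     (q *\<^sub>R frame_matrix 0 0 1 0 0 + (s *\<^sub>R frame_matrix 0 0 0 1 0 + t *\<^sub>R frame_matrix 0 0 0 0 1)))"
  by (simp add: frame_matrix_def vec_eq_iff forall_4 vector_4)

lemma has_derivative_frame_matrix:
  assumes "(\<omega> has_derivative \<omega>') F" "(p has_derivative p') F" "(q has_derivative q') F"
    "(s has_derivative s') F" "(t has_derivative t') F"
  shows "((\<lambda>x. frame_matrix (\<omega> x) (p x) (q x) (s x) (t x)) has_derivative
    (\<lambda>h. frame_matrix (\<omega>' h) (p' h) (q' h) (s' h) (t' h))) F"
  by (subst (1 2) frame_matrix_linear) (intro has_derivative_add has_derivative_scaleR_left assms)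

lemma ck_on_frame_matrix:
  assumes "open U" "ck_on k U \<omega>" "ck_on k U p" "ck_on k U q" "ck_on k U s" "ck_on k U t"
  shows "ck_on k U (\<lambda>x. frame_matrix (\<omega> x) (p x) (q x) (s x) (t x))"
  by (subst frame_matrix_linear)
    (intro ck_on_add[OF assms(1)] ck_on_bilinear[OF assms(1) bounded_bilinear_scaleR] ck_on_const assms)

text \<open>Let \<open>Y\<close> have the rows \<open>e\<^sub>1, e\<^sub>2, n\<close>, so that \<open>Y' = K Y\<close> with \<open>K\<close> skew-symmetric. Then \<open>(Y\<^sup>T Y)' = Y\<^sup>T (K\<^sup>T + K) Y = 0\<close>,
  so \<open>Y\<^sup>T Y\<close> (the functions \<open>G k l\<close>) is constant; for the Gram matrix \<open>Y Y\<^sup>T\<close> one would only get a linear differential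
  equation. The determinant (the function \<open>D\<close>) is constant since \<open>K\<close> has trace zero, and
  fixes the sign of \<open>n\<close>.\<close>

lemma orthonormal_frame_const:
  fixes X :: "real^2 \<Rightarrow> real^3^4"
  assumes der: "\<And>p. p \<in> strip a b \<Longrightarrow> (X has_derivative (\<lambda>h. h $ 1 *\<^sub>R (A p ** X p) + h $ 2 *\<^sub>R (B p ** X p))) (at p)"
    and A: "\<And>p. p \<in> strip a b \<Longrightarrow> \<exists>\<omega> r q s t. A p = frame_matrix \<omega> r q s t"
    and B: "\<And>p. p \<in> strip a b \<Longrightarrow> \<exists>\<omega> r q s t. B p = frame_matrix \<omega> r q s t"
    and init: "base \<in> strip a b" "X base = vector [axis 1 1, axis 2 1, axis 3 1, 0]"
    and p: "p \<in> strip a b"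
  shows "X p $ 1 \<bullet> X p $ 1 = 1" "X p $ 2 \<bullet> X p $ 2 = 1" "X p $ 1 \<bullet> X p $ 2 = 0"
    "X p $ 3 = cross3 (X p $ 1) (X p $ 2)"
proof -
  have comp: "((\<lambda>p. X p $ i $ k) has_derivative (\<lambda>h. h $ 1 * (A p ** X p) $ i $ k + h $ 2 * (B p ** X p) $ i $ k)) (at p)"
    if "p \<in> strip a b" for p i k
    using bounded_linear.has_derivative[OF bounded_linear_vec_nth[of k]
        bounded_linear.has_derivative[OF bounded_linear_vec_nth[of i] der[OF that]]] by simp
  define G where "G = (\<lambda>k l p. X p $ 1 $ k * X p $ 1 $ l + X p $ 2 $ k * X p $ 2 $ l + X p $ 3 $ k * X p $ 3 $ l)"
  have "(G k l has_derivative (\<lambda>h. 0)) (at p)" if "p \<in> strip a b" for p k l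
  proof -
    obtain w r q s t where A': "A p = frame_matrix w r q s t" using A \<open>p \<in> strip a b\<close> by blast
    obtain w' r' q' s' t' where B': "B p = frame_matrix w' r' q' s' t'" using B \<open>p \<in> strip a b\<close> by blast
    note c = comp[OF that]
    show ?thesis unfolding G_def
      by (rule has_derivative_eq_rhs[OF has_derivative_add[OF has_derivative_add[OF has_derivative_mult[OF c c]
            has_derivative_mult[OF c c]] has_derivative_mult[OF c c]]])
        (simp add: fun_eq_iff A' B' frame_matrix_mult_nth algebra_simps)
  qed
  from constant_on_strip[OF this p init(1)] have G: "G k l p = (if k = l then 1 else 0)" for k l
    using exhaust_3[of k] exhaust_3[of l] by (auto simp: G_def init(2) vector_4 axis_def)
  define Y :: "real^3^3" where "Y = vector [X p $ 1, X p $ 2, X p $ 3]"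
  have "transpose Y ** Y = mat 1"
    using G by (simp add: vec_eq_iff matrix_matrix_mult_def transpose_def sum_3 Y_def G_def mat_def)
  then have "Y ** transpose Y = mat 1" by (simp add: matrix_left_right_inverse)
  then have dot: "X p $ 1 \<bullet> X p $ 1 = 1" "X p $ 2 \<bullet> X p $ 2 = 1" "X p $ 1 \<bullet> X p $ 2 = 0"
     "X p $ 3 \<bullet> X p $ 1 = 0" "X p $ 3 \<bullet> X p $ 2 = 0" "X p $ 3 \<bullet> X p $ 3 = 1"
    by (simp_all add: vec_eq_iff matrix_matrix_mult_def transpose_def forall_3 Y_def mat_def inner_vec_def)
  then show "X p $ 1 \<bullet> X p $ 1 = 1" "X p $ 2 \<bullet> X p $ 2 = 1" "X p $ 1 \<bullet> X p $ 2 = 0" by simp_all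
  define D where "D = (\<lambda>p. 
     X p $ 3 $ 1 * (X p $ 1 $ 2 * X p $ 2 $ 3 - X p $ 1 $ 3 * X p $ 2 $ 2)
   + X p $ 3 $ 2 * (X p $ 1 $ 3 * X p $ 2 $ 1 - X p $ 1 $ 1 * X p $ 2 $ 3)
   + X p $ 3 $ 3 * (X p $ 1 $ 1 * X p $ 2 $ 2 - X p $ 1 $ 2 * X p $ 2 $ 1))"
  have "(D has_derivative (\<lambda>h. 0)) (at p)" if "p \<in> strip a b" for p
  proof -
    obtain w r q s t where A': "A p = frame_matrix w r q s t" using A \<open>p \<in> strip a b\<close> by blast
    obtain w' r' q' s' t' where B': "B p = frame_matrix w' r' q' s' t'" using B \<open>p \<in> strip a b\<close> by blast
    note c = comp[OF that]
    note m = has_derivative_mult[OF c has_derivative_diff[OF has_derivative_mult[OF c c] has_derivative_mult[OF c c]]]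
    show ?thesis unfolding D_def
      by (rule has_derivative_eq_rhs[OF has_derivative_add[OF has_derivative_add[OF m m] m]])
        (simp add: fun_eq_iff A' B' frame_matrix_mult_nth algebra_simps)
  qed
  from constant_on_strip[OF this p init(1)] have "D p = 1"
    by (simp add: D_def init(2) vector_4 axis_def)
  then have D1: "X p $ 3 \<bullet> cross3 (X p $ 1) (X p $ 2) = 1"
    by (simp add: D_def cross3_def inner_vec_def sum_3 algebra_simps)
  have "(norm (cross3 (X p $ 1) (X p $ 2)))\<^sup>2 = 1"
    using norm_cross_dot[of "X p $ 1" "X p $ 2"] dot(1-3) by (simp add: power_mult_distrib power2_norm_eq_inner)
  then have "(X p $ 3 - cross3 (X p $ 1) (X p $ 2)) \<bullet> (X p $ 3 - cross3 (X p $ 1) (X p $ 2)) = 0"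
    using D1 dot(6) by (simp add: inner_diff_left inner_diff_right power2_norm_eq_inner inner_commute)
  then show "X p $ 3 = cross3 (X p $ 1) (X p $ 2)" by simp
qed

context cmc_profile
begin

text \<open>The entries of \<open>\<rho> S\<close>, which are the coefficients of the second fundamental form paired with one
  coordinate vector and one vector of the orthonormal frame.\<close>

definition P :: "real^2 \<Rightarrow> real" where "P p = \<rho> (p $ 1) * (H / 2 + \<mu> (p $ 1) * cos (2 * a * p $ 2))"
definition Q :: "real^2 \<Rightarrow> real" where "Q p = \<rho> (p $ 1) * (- (\<mu> (p $ 1) * sin (2 * a * p $ 2)))"
definition R :: "real^2 \<Rightarrow> real" where "R p = \<rho> (p $ 1) * (H / 2 - \<mu> (p $ 1) * cos (2 * a * p $ 2))"

definition A where "A p = frame_matrix 0 (P p) (Q p) (\<rho> (p $ 1)) 0"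
definition B where "B p = frame_matrix (w (p $ 1)) (Q p) (R p) 0 (\<rho> (p $ 1))"

abbreviation "U \<equiv> strip u1 u2"

lemma continuous_on_strip_of_u:
  assumes "continuous_on (einterval u1 u2) \<phi>"
  shows "continuous_on U (\<lambda>p. \<phi> (p $ 1))"
  by (rule continuous_on_compose2[OF assms]) (auto intro!: continuous_intros strip_nth)

lemma continuous_on_profile:
  "continuous_on (einterval u1 u2) \<rho>" "continuous_on (einterval u1 u2) \<rho>1"
  "continuous_on (einterval u1 u2) w" "continuous_on (einterval u1 u2) \<mu>"
  by (rule continuous_at_imp_continuous_on, blast intro: DERIV_isCont d1 d2 has_derivative_w has_derivative_\<mu>)+

text \<open>The second derivative is continuous because the profile equation expresses it through
  \<open>\<rho>\<close> and \<open>\<rho>'\<close>. This is what makes \<open>f\<close> three times continuously differentiable: \<open>df = \<rho> (e\<^sub>1 du + e\<^sub>2 dv)\<close>.\<close>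

lemma ck_on_\<rho>: "ck_on 2 U (\<lambda>p. \<rho> (p $ 1))"
proof -
  have eq: "\<rho>2 u = ((\<rho>1 u)\<^sup>2 - 1/4 * H\<^sup>2 * \<rho> u ^ 4 + b\<^sup>2 * exp (4 * a * u)) / \<rho> u" if "u \<in> einterval u1 u2" for u
    using profile[OF that] pos[OF that] by (simp add: field_simps)
  have "continuous_on (einterval u1 u2) \<rho>2"
    by (rule continuous_on_cong[THEN iffD2, OF refl eq])
      (use pos in \<open>auto intro!: continuous_intros continuous_on_profile simp: less_imp_neq[symmetric]\<close>)
  then have "ck_on 0 U (\<lambda>p. \<rho>2 (p $ 1))" by (simp add: continuous_on_strip_of_u)
  then show ?thesis
    unfolding numeral_2_eq_2
    by (intro ck_on_Suc_nth_compose[where \<phi>' = \<rho>1] ck_on_Suc_nth_compose[where \<phi>' = \<rho>2] open_strip d1 d2 strip_nth)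
qed

lemma ck_on_coefficients: "ck_on 1 U A" "ck_on 1 U B"
proof -
  have r: "ck_on 1 U (\<lambda>p. \<rho> (p $ 1))" 
    by (rule ck_on_SucD) (use ck_on_\<rho> in \<open>simp only: numeral_2_eq_2 One_nat_def\<close>)
  have \<mu>: "ck_on 1 U (\<lambda>p. \<mu> (p $ 1))"
    unfolding One_nat_def
    by (rule ck_on_Suc_nth_compose[OF open_strip has_derivative_\<mu>[OF strip_nth]], assumption, unfold ck_on.simps,
        rule continuous_on_strip_of_u) (intro continuous_intros continuous_on_profile)
  have w: "ck_on 1 U (\<lambda>p. w (p $ 1))"
    unfolding One_nat_def
    by (rule ck_on_Suc_nth_compose[OF open_strip has_derivative_w[OF strip_nth]], assumption, unfold ck_on.simps,
        rule continuous_on_strip_of_u) (intro continuous_intros continuous_on_profile)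
  have c: "ck_on 1 U (\<lambda>p. cos (2 * a * p $ 2))"
    unfolding One_nat_def
    by (rule ck_on_Suc_nth_compose[where \<phi> = "\<lambda>v. cos (2 * a * v)" and \<phi>' = "\<lambda>v. - sin (2 * a * v) * (2 * a)", OF open_strip])
      (auto intro!: derivative_eq_intros continuous_intros)
  have s: "ck_on 1 U (\<lambda>p. sin (2 * a * p $ 2))"
    unfolding One_nat_def
    by (rule ck_on_Suc_nth_compose[where \<phi> = "\<lambda>v. sin (2 * a * v)" and \<phi>' = "\<lambda>v. cos (2 * a * v) * (2 * a)", OF open_strip])
      (auto intro!: derivative_eq_intros continuous_intros)
  note mult = ck_on_bilinear[OF open_strip bounded_bilinear_mult]
  note add = ck_on_add[OF open_strip]
  note neg = ck_on_bounded_linear[OF open_strip bounded_linear_minus[OF bounded_linear_ident]]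
  have P: "ck_on 1 U P" unfolding P_def[abs_def] by (intro mult add \<mu> c r ck_on_const open_strip)
  have Q: "ck_on 1 U Q" unfolding Q_def[abs_def] by (intro mult neg \<mu> s r)
  have R: "ck_on 1 U R" unfolding R_def[abs_def] diff_conv_add_uminus
    by (intro mult add neg \<mu> c r ck_on_const open_strip)
  show "ck_on 1 U A" "ck_on 1 U B" unfolding A_def[abs_def] B_def[abs_def]
    by (intro ck_on_frame_matrix P Q R w r ck_on_const open_strip)+
qed

text \<open>Of the entries of this matrix identity, \<open>(1,2)\<close> is the Gauss equation, \<open>(1,3)\<close> and \<open>(2,3)\<close> are
  the Codazzi equations, and \<open>(4,2)\<close> is the symmetry of the second derivatives of \<open>f\<close>.\<close>

lemma compatibility:
  assumes p: "p \<in> U"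
  shows "partial 2 A p + A p ** B p = partial 1 B p + B p ** A p"
proof -
  let ?u = "p $ 1"
  have u: "?u \<in> einterval u1 u2" using p by (rule strip_nth)
  define c s where "c = cos (2 * a * p $ 2)" and "s = sin (2 * a * p $ 2)"
  define m m' where "m = \<mu> ?u" and "m' = 2 * (a - w ?u) * m"
  have dr: "((\<lambda>q :: real^2. \<rho> (q $ 1)) has_derivative (\<lambda>h. h $ 1 * \<rho>1 ?u)) (at p)"
    by (rule has_derivative_nth_compose[OF d1[OF u]])
  have dm: "((\<lambda>q :: real^2. \<mu> (q $ 1)) has_derivative (\<lambda>h. h $ 1 * m')) (at p)"
    using has_derivative_nth_compose[OF has_derivative_\<mu>[OF u]] by (simp add: m_def m'_def)
  have dW: "((\<lambda>q :: real^2. w (q $ 1)) has_derivative (\<lambda>h. h $ 1 * ((\<rho> ?u)\<^sup>2 * (m\<^sup>2 - H\<^sup>2 / 4)))) (at p)"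
    using has_derivative_nth_compose[OF has_derivative_w[OF u]] by (simp add: m_def)
  have dc: "((\<lambda>q :: real^2. cos (2 * a * q $ 2)) has_derivative (\<lambda>h. h $ 2 * (- s * (2 * a)))) (at p)"
    unfolding s_def by (rule has_derivative_cos_v)
  have ds: "((\<lambda>q :: real^2. sin (2 * a * q $ 2)) has_derivative (\<lambda>h. h $ 2 * (c * (2 * a)))) (at p)"
    unfolding c_def by (rule has_derivative_sin_v)
  note mc = has_derivative_mult[OF dm dc] and ms = has_derivative_mult[OF dm ds]
  note dP = has_derivative_mult[OF dr has_derivative_add[OF has_derivative_const[of "H / 2"] mc]]
  note dQ = has_derivative_mult[OF dr has_derivative_minus[OF ms]]
  note dR = has_derivative_mult[OF dr has_derivative_diff[OF has_derivative_const[of "H / 2"] mc]]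
  note dA = has_derivative_frame_matrix[OF has_derivative_const[of 0] dP dQ dr has_derivative_const[of 0]]
  note dB = has_derivative_frame_matrix[OF dW dQ dR has_derivative_const[of 0] dr]
  have rw: "\<rho>1 ?u = \<rho> ?u * w ?u" using pos[OF u] by (simp add: w_def)
  have cs: "c * (c * x) = x - s * (s * x)" for x
  proof -
    have "c\<^sup>2 = 1 - s\<^sup>2" by (simp add: c_def s_def cos_squared_eq)
    then have "c\<^sup>2 * x = (1 - s\<^sup>2) * x" by simp
    then show ?thesis by (simp add: power2_eq_square algebra_simps)
  qed
  have pA: "partial 2 A p = frame_matrix 0 (\<rho> ?u * (m * (- s * (2 * a)))) (\<rho> ?u * (- (m * (c * (2 * a))))) 0 0"
    unfolding A_def[abs_def] P_def[abs_def] Q_def[abs_def]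
    by (subst partial_eq[OF dA]) (simp add: axis_def m_def)
  have pB: "partial 1 B p = frame_matrix ((\<rho> ?u)\<^sup>2 * (m\<^sup>2 - H\<^sup>2 / 4)) (\<rho> ?u * (- (m' * s)) + \<rho>1 ?u * (- (m * s)))
      (\<rho> ?u * (- (m' * c)) + \<rho>1 ?u * (H / 2 - m * c)) 0 (\<rho>1 ?u)"
    unfolding B_def[abs_def] Q_def[abs_def] R_def[abs_def]
    by (subst partial_eq[OF dB]) (simp add: axis_def m_def c_def s_def)
  show ?thesis
    unfolding pA pB A_def B_def P_def Q_def R_def m_def[symmetric] c_def[symmetric] s_def[symmetric] rw m'_def frame_matrix_def
    by (simp add: vec_eq_iff forall_4 matrix_matrix_mult_def sum_4 vector_4 power2_eq_square)
      (simp add: algebra_simps cs)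
qed

text \<open>Bonnet's theorem for these data: the immersion is the last row of the solution \<open>X\<close> that starts with
  the standard basis at a point of the axis, and both fundamental forms are read off from the system.\<close>

theorem surface_exists:
  assumes t0: "t0 \<in> einterval u1 u2"
  shows "\<exists>f. intrinsic_surface_of_revolution u1 u2 \<rho> f \<and> (\<forall>p\<in>U. shape_operator f p = shape p)"
proof -
  define X0 :: "real^3^4" where "X0 = vector [axis 1 1, axis 2 1, axis 3 1, 0]"
  obtain X where X0: "X (pt t0 0) = X0"
    and X: "\<And>p. p \<in> U \<Longrightarrow> (X has_derivative (\<lambda>h. h $ 1 *\<^sub>R (A p ** X p) + h $ 2 *\<^sub>R (B p ** X p))) (at p)"
    by (rule overdetermined_linear_system_solvable[OF ck_on_coefficients _ t0, of X0]) (erule compatibility, rule that)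
  have t0U: "pt t0 0 \<in> U" using t0 by simp
  have frameA: "\<exists>\<omega> r q s t. A p = frame_matrix \<omega> r q s t" and frameB: "\<exists>\<omega> r q s t. B p = frame_matrix \<omega> r q s t" for p
    unfolding A_def B_def by blast+
  have "X p $ 1 \<bullet> X p $ 1 = 1 \<and> X p $ 2 \<bullet> X p $ 2 = 1 \<and> X p $ 1 \<bullet> X p $ 2 = 0 \<and>
    X p $ 3 = cross3 (X p $ 1) (X p $ 2)" if "p \<in> U" for p
    by (intro conjI; rule orthonormal_frame_const[where X = X and A = A and B = B and base = "pt t0 0" and a = u1 and b = u2];
        (erule X | rule frameA | rule frameB | rule t0U | rule that | simp add: X0 X0_def))
  then have frame: "X p $ 1 \<bullet> X p $ 1 = 1" "X p $ 2 \<bullet> X p $ 2 = 1" "X p $ 1 \<bullet> X p $ 2 = 0"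
    "X p $ 3 = cross3 (X p $ 1) (X p $ 2)" if "p \<in> U" for p
    using that by blast+
  define f where "f = (\<lambda>p. X p $ 4)"
  have row: "((\<lambda>p. X p $ i) has_derivative (\<lambda>h. h $ 1 *\<^sub>R (A p ** X p) $ i + h $ 2 *\<^sub>R (B p ** X p) $ i)) (at p)"
    if "p \<in> U" for p i
    using bounded_linear.has_derivative[OF bounded_linear_vec_nth[of i] X[OF that]] by simp
  have Df: "(f has_derivative (\<lambda>h. (h $ 1 * \<rho> (p $ 1)) *\<^sub>R X p $ 1 + (h $ 2 * \<rho> (p $ 1)) *\<^sub>R X p $ 2)) (at p)"
    if "p \<in> U" for p
    unfolding f_def using row[OF that, of 4] by (simp add: A_def B_def frame_matrix_mult_nth)
  have f1: "partial 1 f p = \<rho> (p $ 1) *\<^sub>R X p $ 1" and f2: "partial 2 f p = \<rho> (p $ 1) *\<^sub>R X p $ 2" if "p \<in> U" for p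
    by (simp_all add: partial_eq[OF Df[OF that]] axis_def)
  \<comment> \<open>each use of the system gains one derivative: the coefficients are \<open>C\<^sup>1\<close>, so \<open>X\<close> is \<open>C\<^sup>2\<close>\<close>
  have partX: "partial i X p = (if i = 1 then A p ** X p else B p ** X p)" if "p \<in> U" for p i
    using exhaust_2[of i] by (auto simp: partial_eq[OF X[OF that]] axis_def)
  have ckX_step: "ck_on (Suc k) U X" if "ck_on k U X" "ck_on k U A" "ck_on k U B" for k
  proof (rule ck_on_SucI_has_derivative[OF open_strip X])
    fix i :: 2
    have AX: "ck_on k U (\<lambda>p. A p ** X p)" and BX: "ck_on k U (\<lambda>p. B p ** X p)"
      using that by (auto intro!: ck_on_bilinear[OF open_strip bounded_bilinear_matrix_mult])
    show "ck_on k U (partial i X)"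
      by (cases "i = 1"; rule ck_on_transfer[OF _ open_strip partX]) (use AX BX in simp_all)
  qed
  have "ck_on 0 U X"
    using X by (auto intro!: continuous_at_imp_continuous_on intro: has_derivative_continuous)
  then have "ck_on 1 U X"
    using ckX_step[of 0] ck_on_coefficients ck_on_SucD[of 0 U A] ck_on_SucD[of 0 U B] by (simp only: One_nat_def)
  then have ckX: "ck_on 2 U X"
    using ckX_step[of 1] ck_on_coefficients by (simp only: One_nat_def numeral_2_eq_2)
  have ckXi: "ck_on 2 U (\<lambda>p. \<rho> (p $ 1) *\<^sub>R X p $ i)" for i
    by (intro ck_on_bilinear[OF open_strip bounded_bilinear_scaleR] ck_on_\<rho>
        ck_on_bounded_linear[OF open_strip bounded_linear_vec_nth ckX])
  have "ck_on 2 U (partial i f)" for i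
    using exhaust_2[of i] ck_on_transfer[OF ckXi open_strip f1] ck_on_transfer[OF ckXi open_strip f2] by auto
  then have "ck_on 3 U f"
    unfolding numeral_3_eq_3 numeral_2_eq_2[symmetric] by (intro ck_on_SucI_has_derivative[OF open_strip Df])
  moreover have "inj (frechet_derivative f (at p))" if p: "p \<in> U" for p
  proof (rule injI)
    fix g h :: "real^2" assume "frechet_derivative f (at p) g = frechet_derivative f (at p) h"
    then have e: "(g $ 1 * \<rho> (p $ 1)) *\<^sub>R X p $ 1 + (g $ 2 * \<rho> (p $ 1)) *\<^sub>R X p $ 2
        = (h $ 1 * \<rho> (p $ 1)) *\<^sub>R X p $ 1 + (h $ 2 * \<rho> (p $ 1)) *\<^sub>R X p $ 2"
      by (simp add: frechet_derivative_eq[OF Df[OF p]])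
    have "X p $ 2 \<bullet> X p $ 1 = 0" using frame(3)[OF p] by (simp add: inner_commute)
    with arg_cong[OF e, of "\<lambda>z. X p $ 1 \<bullet> z"] arg_cong[OF e, of "\<lambda>z. X p $ 2 \<bullet> z"]
    show "g = h" using frame(1-3)[OF p] pos[OF strip_nth[OF p]]
      by (simp add: vec_eq_iff forall_2 inner_add_right)
  qed
  moreover have ff: "first_fundamental_form f p = revolution_metric \<rho> p" if p: "p \<in> U" for p
    using frame(1-3)[OF p]
    by (simp add: vec_eq_iff forall_2 first_fundamental_form_nth f1[OF p] f2[OF p] revolution_metric_def mat_def
        power2_eq_square inner_commute)
  moreover have "shape_operator f p = shape p" if p: "p \<in> U" for p
  proof (rule shape_operator_eqI)
    show "first_fundamental_form f p = mat ((\<rho> (p $ 1))\<^sup>2)" using ff[OF p] by (simp add: revolution_metric_def)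
    show "(\<rho> (p $ 1))\<^sup>2 \<noteq> 0" using pos[OF strip_nth[OF p]] by simp
    have gm: "gauss_map f q = X q $ 3" if q: "q \<in> U" for q
    proof -
      have "X q $ 3 \<bullet> X q $ 3 = 1"
        using norm_cross_dot[of "X q $ 1" "X q $ 2"] frame[OF q]
        by (simp add: power_mult_distrib power2_norm_eq_inner)
      then have "norm (X q $ 3) = 1" by (simp add: norm_eq_sqrt_inner)
      then show ?thesis
        using pos[OF strip_nth[OF q]]
        by (simp add: gauss_map_def f1[OF q] f2[OF q] cross_mult_left cross_mult_right frame(4)[OF q, symmetric]
            sgn_scaleR) (simp add: sgn_div_norm)
    qed
    have gmp: "partial i (gauss_map f) p = partial i (\<lambda>q. X q $ 3) p" for i
      by (rule partial_cong_open[OF open_strip p gm])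
    show "partial i (gauss_map f) p = - (shape p $ 1 $ i *\<^sub>R partial 1 f p + shape p $ 2 $ i *\<^sub>R partial 2 f p)" for i
      using exhaust_2[of i]
      by (auto simp: gmp partial_eq[OF row[OF p]] axis_def A_def B_def frame_matrix_mult_nth f1[OF p] f2[OF p] shape_def
          P_def Q_def R_def algebra_simps)
  qed
  ultimately show ?thesis
    unfolding intrinsic_surface_of_revolution_def c3_immersion_def using pos by blast
qed

end

section \<open>From the surface to the profile equation\<close>

lemma orthonormal_expansion:
  fixes e1 e2 e3 z :: "real^3"
  assumes "e1 \<bullet> e1 = 1" "e2 \<bullet> e2 = 1" "e3 \<bullet> e3 = 1" "e1 \<bullet> e2 = 0" "e1 \<bullet> e3 = 0" "e2 \<bullet> e3 = 0"
  shows "z = (z \<bullet> e1) *\<^sub>R e1 + (z \<bullet> e2) *\<^sub>R e2 + (z \<bullet> e3) *\<^sub>R e3"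
proof -
  define Y :: "real^3^3" where "Y = vector [e1, e2, e3]"
  have "Y ** transpose Y = mat 1"
    using assms
    by (simp add: vec_eq_iff matrix_matrix_mult_def transpose_def forall_3 Y_def mat_def inner_vec_def mult.commute)
  then have "transpose Y ** Y = mat 1" by (simp add: matrix_left_right_inverse)
  then have "transpose Y *v (Y *v z) = z" by (simp add: matrix_vector_mul_assoc)
  moreover have "transpose Y *v (Y *v z) = (z \<bullet> e1) *\<^sub>R e1 + (z \<bullet> e2) *\<^sub>R e2 + (z \<bullet> e3) *\<^sub>R e3"
    by (simp add: vec_eq_iff matrix_vector_mult_def transpose_def sum_3 Y_def inner_vec_def forall_3 algebra_simps)
  ultimately show ?thesis by simp
qed

lemma partial_inner:
  fixes F G :: "real^2 \<Rightarrow> 'a::real_inner"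
  assumes "F differentiable at p" "G differentiable at p"
  shows "partial k (\<lambda>q. F q \<bullet> G q) p = partial k F p \<bullet> G p + F p \<bullet> partial k G p"
  using partial_eq[OF bounded_bilinear.FDERIV[OF bounded_bilinear_inner
        assms[unfolded frechet_derivative_works]], of k]
  by (simp add: partial_def)

lemma partial_of_u:
  assumes "(\<phi> has_real_derivative d) (at (p $ 1))"
  shows "partial k (\<lambda>q. \<phi> (q $ 1)) p = (if k = 1 then d else 0)"
  using partial_eq[OF has_derivative_nth_compose[OF assms], of k] by (simp add: axis_def)

text \<open>The equations are obtained at the level of the maps \<open>F i = \<partial>\<^sub>i f\<close>, by differentiating the inner products
  of \<open>F 1\<close>, \<open>F 2\<close> and the normal \<open>n\<close>. The Codazzi equation for the entries \<open>(2,1)\<close> and \<open>(2,2)\<close> is evaluated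
  on the line \<open>v = 0\<close>, where \<open>sin (2 a v)\<close> has derivative \<open>2 a\<close> and \<open>cos (2 a v) = 1\<close>, so that it becomes
  the scalar equation \<open>k' = 2 a k\<close> for \<open>k = \<rho>\<^sup>2 \<mu>\<close>.\<close>

theorem cmc_twisted_profile:
  fixes f :: "real^2 \<Rightarrow> real^3"
  assumes surf: "intrinsic_surface_of_revolution u1 u2 \<rho> f"
    and twist: "has_twist u1 u2 f (\<lambda>v. a * v) lam1 lam2"
    and cmc: "\<And>p. p \<in> strip u1 u2 \<Longrightarrow> mean_curvature f p = H"
  shows "\<exists>b. cmc_profile_equation u1 u2 H a b \<rho>"
proof -
  let ?I = "einterval u1 u2" and ?U = "strip u1 u2"
  define F where "F = (\<lambda>i. partial i f)"
  define n where "n = gauss_map f"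
  have ckf: "ck_on 3 ?U f" and pos: "\<And>u. u \<in> ?I \<Longrightarrow> \<rho> u > 0"
    and ff: "\<And>p. p \<in> ?U \<Longrightarrow> first_fundamental_form f p = revolution_metric \<rho> p"
    using surf unfolding intrinsic_surface_of_revolution_def c3_immersion_def by blast+
  have ckF: "ck_on 2 ?U (F i)" for i using ckf unfolding numeral_3_eq_3 F_def numeral_2_eq_2 ck_on.simps(2) by blast
  have ckF': "ck_on 1 ?U (partial j (F i))" for i j
    using ckF[of i] unfolding numeral_2_eq_2 One_nat_def ck_on.simps(2) by blast
  have dF: "F i differentiable at p" and dF': "partial j (F i) differentiable at p" if "p \<in> ?U" for i j p
    using ckF[of i] ckF'[of j i] that unfolding numeral_2_eq_2 One_nat_def ck_on.simps(2)
    by (auto simp: differentiable_on_eq_differentiable_at)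
  have ck2f: "ck_on 2 ?U f" using ck_on_SucD[of 2 ?U f] ckf by (simp only: numeral_3_eq_3 numeral_2_eq_2)
  have metric: "F i p \<bullet> F j p = (if i = j then (\<rho> (p $ 1))\<^sup>2 else 0)" if "p \<in> ?U" for i j p
    using arg_cong[OF ff[OF that], of "\<lambda>m. m $ i $ j"]
    by (simp add: first_fundamental_form_nth F_def revolution_metric_def mat_def)
  have F21: "partial 1 (F 2) p = partial 2 (F 1) p" if "p \<in> ?U" for p
    unfolding F_def by (rule partial_commute[OF open_strip that ck2f])
  have F112: "partial 1 (partial 2 (F 1)) p = partial 2 (partial 1 (F 1)) p" if "p \<in> ?U" for p
    by (rule partial_commute[OF open_strip that ckF])

  \<comment> \<open>\<open>\<rho>\<close> is the square root of the positive \<open>C\<^sup>2\<close> function \<open>\<bar>f\<^sub>u\<bar>\<^sup>2\<close>\<close>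
  define E where "E = (\<lambda>q. F 1 q \<bullet> F 1 q)"
  have ckE: "ck_on 2 ?U E" unfolding E_def by (rule ck_on_bilinear[OF open_strip bounded_bilinear_inner ckF ckF])
  have dE: "E differentiable at p" "partial i E differentiable at p" if "p \<in> ?U" for p i
    using ckE that unfolding numeral_2_eq_2 One_nat_def ck_on.simps(2)
    by (auto simp: differentiable_on_eq_differentiable_at)
  define e where "e = (\<lambda>u. E (pt u 0))"
  define e1 where "e1 = (\<lambda>u. partial 1 E (pt u 0))"
  define e2 where "e2 = (\<lambda>u. partial 1 (partial 1 E) (pt u 0))"
  have de: "(e has_real_derivative e1 u) (at u)" and de1: "(e1 has_real_derivative e2 u) (at u)" if "u \<in> ?I" for u
    using has_vector_derivative_partial_u[OF dE(1)[of "pt u 0"]]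
      has_vector_derivative_partial_u[OF dE(2)[of "pt u 0" 1]] that
    unfolding e_def e1_def e2_def by (simp_all add: has_real_derivative_iff_has_vector_derivative)
  have e: "e u = (\<rho> u)\<^sup>2" if "u \<in> ?I" for u
    using metric[of "pt u 0" 1 1] that by (simp add: e_def E_def)
  define \<rho>1 where "\<rho>1 = (\<lambda>u. e1 u / (2 * \<rho> u))"
  define \<rho>2 where "\<rho>2 = (\<lambda>u. (e2 u * (2 * \<rho> u) - e1 u * (2 * \<rho>1 u)) / (2 * \<rho> u * (2 * \<rho> u)))"
  have d1: "(\<rho> has_real_derivative \<rho>1 u) (at u)" if u: "u \<in> ?I" for u
  proof -
    have "((\<lambda>u. sqrt (e u)) has_real_derivative inverse (sqrt (e u)) / 2 * e1 u) (at u)"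
      using DERIV_chain2[OF DERIV_real_sqrt de[OF u]] e[OF u] pos[OF u] by simp
    then have "((\<lambda>u. sqrt (e u)) has_real_derivative \<rho>1 u) (at u)"
      using e[OF u] pos[OF u] by (simp add: \<rho>1_def field_simps)
    then show ?thesis
      by (rule has_field_derivative_transform_within_open[OF _ open_einterval u]) (use e pos in \<open>simp add: less_imp_le\<close>)
  qed
  have d2: "(\<rho>1 has_real_derivative \<rho>2 u) (at u)" if u: "u \<in> ?I" for u
    unfolding \<rho>1_def \<rho>2_def
    using DERIV_divide[OF de1[OF u] DERIV_cmult[OF d1[OF u], of 2]] pos[OF u] by (simp add: \<rho>1_def)

  \<comment> \<open>the Christoffel symbols of the first kind, from the derivatives of \<open>F i \<bullet> F j = \<rho>\<^sup>2 \<delta>\<^sub>i\<^sub>j\<close>\<close>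
  have chr: "partial k (F i) p \<bullet> F j p + F i p \<bullet> partial k (F j) p
      = (if i = j \<and> k = 1 then 2 * (\<rho> (p $ 1) * \<rho>1 (p $ 1)) else 0)" if p: "p \<in> ?U" for i j k p
  proof -
    have "partial k (F i) p \<bullet> F j p + F i p \<bullet> partial k (F j) p = partial k (\<lambda>q. F i q \<bullet> F j q) p"
      by (rule partial_inner[symmetric]) (rule dF[OF p])+
    also have "\<dots> = partial k (\<lambda>q. if i = j then (\<rho> (q $ 1))\<^sup>2 else 0) p"
      by (rule partial_cong_open[OF open_strip p metric])
    also have "\<dots> = (if i = j \<and> k = 1 then 2 * (\<rho> (p $ 1) * \<rho>1 (p $ 1)) else 0)"
    proof (cases "i = j")
      case True
      have "((\<lambda>u. (\<rho> u)\<^sup>2) has_real_derivative 2 * (\<rho> (p $ 1) * \<rho>1 (p $ 1))) (at (p $ 1))"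
        by (auto intro!: derivative_eq_intros d1[OF strip_nth[OF p]])
      from partial_of_u[OF this, of k] show ?thesis using True by simp
    next
      case False
      then show ?thesis by (simp add: partial_eq[OF has_derivative_const])
    qed
    finally show ?thesis .
  qed
  have chr': "partial 1 (F 1) p \<bullet> F 1 p = \<rho> (p $ 1) * \<rho>1 (p $ 1)" "partial 2 (F 1) p \<bullet> F 1 p = 0"
      "partial 2 (F 1) p \<bullet> F 2 p = \<rho> (p $ 1) * \<rho>1 (p $ 1)" "partial 2 (F 2) p \<bullet> F 2 p = 0"
      "partial 1 (F 1) p \<bullet> F 2 p = 0" "partial 2 (F 2) p \<bullet> F 1 p = - (\<rho> (p $ 1) * \<rho>1 (p $ 1))" if p: "p \<in> ?U" for p
    using chr[OF p, of 1 1 1] chr[OF p, of 2 1 1] chr[OF p, of 1 2 2] chr[OF p, of 2 2 2]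
      chr[OF p, of 1 1 2] chr[OF p, of 2 1 2] F21[OF p] by (simp_all add: inner_commute)

  \<comment> \<open>\<open>\<bar>F 1 \<times> F 2\<bar> = \<rho>\<^sup>2\<close>, so the normal is a differentiable multiple of \<open>F 1 \<times> F 2\<close>\<close>
  define C where "C = (\<lambda>q. cross3 (F 1 q) (F 2 q))"
  have n_eq: "n q = (1 / (\<rho> (q $ 1))\<^sup>2) *\<^sub>R C q" and CC: "C q \<bullet> C q = ((\<rho> (q $ 1))\<^sup>2)\<^sup>2" if q: "q \<in> ?U" for q
  proof -
    have "(norm (C q))\<^sup>2 = (norm (F 1 q))\<^sup>2 * (norm (F 2 q))\<^sup>2"
      using norm_cross_dot[of "F 1 q" "F 2 q"] metric[OF q, of 1 2] by (simp add: C_def power_mult_distrib)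
    then have nC: "(norm (C q))\<^sup>2 = ((\<rho> (q $ 1))\<^sup>2)\<^sup>2"
      using metric[OF q, of 1 1] metric[OF q, of 2 2]
      by (simp add: power2_norm_eq_inner power2_eq_square[of "(\<rho> (q $ 1))\<^sup>2"])
    then show "C q \<bullet> C q = ((\<rho> (q $ 1))\<^sup>2)\<^sup>2" by (simp add: power2_norm_eq_inner)
    have "norm (C q) = (\<rho> (q $ 1))\<^sup>2" using nC by (rule power2_eq_imp_eq) simp_all
    then show "n q = (1 / (\<rho> (q $ 1))\<^sup>2) *\<^sub>R C q"
      by (simp add: n_def gauss_map_def C_def F_def sgn_div_norm inverse_eq_divide)
  qed
  have nF: "n q \<bullet> F i q = 0" "F i q \<bullet> n q = 0" and nn: "n q \<bullet> n q = 1" if q: "q \<in> ?U" for q i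
    using exhaust_2[of i] CC[OF q] pos[OF strip_nth[OF q]]
    by (auto simp: n_eq[OF q] C_def dot_cross_self power2_eq_square)
  have dn: "n differentiable at p" if p: "p \<in> ?U" for p
  proof -
    have "((\<lambda>u. 1 / (\<rho> u)\<^sup>2) has_real_derivative (0 * (\<rho> (p $ 1))\<^sup>2 - 1 * (2 * \<rho> (p $ 1) * \<rho>1 (p $ 1))) / ((\<rho> (p $ 1))\<^sup>2 * (\<rho> (p $ 1))\<^sup>2)) (at (p $ 1))"
      using pos[OF strip_nth[OF p]]
      by (intro DERIV_divide) (auto intro!: derivative_eq_intros d1[OF strip_nth[OF p]])
    note D1 = has_derivative_nth_compose[OF this]
    have "bounded_bilinear cross3" using bilinear_cross by (simp add: bilinear_conv_bounded_bilinear)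
    note D2 = bounded_bilinear.FDERIV[OF this dF[OF p, of 1, unfolded frechet_derivative_works] dF[OF p, of 2, unfolded frechet_derivative_works]]
    have "((\<lambda>q. (1 / (\<rho> (q $ 1))\<^sup>2) *\<^sub>R C q) differentiable at p)"
      unfolding C_def using has_derivative_scaleR[OF D1 D2] differentiableI by blast
    then obtain D where "((\<lambda>q. (1 / (\<rho> (q $ 1))\<^sup>2) *\<^sub>R C q) has_derivative D) (at p)"
      unfolding differentiable_def by blast
    then have "(n has_derivative D) (at p)"
      by (rule has_derivative_transform_within_open[OF _ open_strip p]) (simp add: n_eq)
    then show ?thesis by (rule differentiableI)
  qed
  have nj: "partial j n p \<bullet> F i p = - (n p \<bullet> partial j (F i) p)" and njn: "partial j n p \<bullet> n p = 0"
    if p: "p \<in> ?U" for i j p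
  proof -
    have zero: "partial j (\<lambda>q. c :: real) p = 0" for c by (simp add: partial_eq[OF has_derivative_const])
    have "partial j (\<lambda>q. n q \<bullet> F i q) p = partial j (\<lambda>q. 0) p"
      by (rule partial_cong_open[OF open_strip p nF(1)])
    then show "partial j n p \<bullet> F i p = - (n p \<bullet> partial j (F i) p)"
      by (simp add: partial_inner[OF dn[OF p] dF[OF p]] zero)
    have "partial j (\<lambda>q. n q \<bullet> n q) p = partial j (\<lambda>q. 1) p"
      by (rule partial_cong_open[OF open_strip p nn])
    then show "partial j n p \<bullet> n p = 0"
      by (simp add: partial_inner[OF dn[OF p] dn[OF p]] zero inner_commute)
  qed
  have expand: "z = ((z \<bullet> F 1 p) / (\<rho> (p $ 1))\<^sup>2) *\<^sub>R F 1 p + ((z \<bullet> F 2 p) / (\<rho> (p $ 1))\<^sup>2) *\<^sub>R F 2 p + (z \<bullet> n p) *\<^sub>R n p"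
    if p: "p \<in> ?U" for z p
  proof -
    let ?r = "\<rho> (p $ 1)"
    have r: "?r > 0" using pos[OF strip_nth[OF p]] .
    have "z = (z \<bullet> ((1 / ?r) *\<^sub>R F 1 p)) *\<^sub>R ((1 / ?r) *\<^sub>R F 1 p) + (z \<bullet> ((1 / ?r) *\<^sub>R F 2 p)) *\<^sub>R ((1 / ?r) *\<^sub>R F 2 p)
        + (z \<bullet> n p) *\<^sub>R n p"
      by (rule orthonormal_expansion) (use r metric[OF p] nF[OF p] nn[OF p] in \<open>simp_all add: power2_eq_square\<close>)
    then show ?thesis by (simp add: power2_eq_square)
  qed

  \<comment> \<open>\<open>n\<^sub>j \<bullet> F i = - n \<bullet> \<partial>\<^sub>j F i\<close> turns the definition of \<open>S\<close> by the Gauss map into \<open>h = \<rho>\<^sup>2 S\<close>\<close>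
  define h where "h = (\<lambda>i j q. n q \<bullet> partial j (F i) q)"
  have shape_eq: "shape_operator f p = (\<chi> i j. h i j p / (\<rho> (p $ 1))\<^sup>2)" if p: "p \<in> ?U" for p
  proof (rule shape_operator_eqI)
    show "first_fundamental_form f p = mat ((\<rho> (p $ 1))\<^sup>2)" using ff[OF p] by (simp add: revolution_metric_def)
    show "(\<rho> (p $ 1))\<^sup>2 \<noteq> 0" using pos[OF strip_nth[OF p]] by simp
    show "partial j (gauss_map f) p = - ((\<chi> i j. h i j p / (\<rho> (p $ 1))\<^sup>2) $ 1 $ j *\<^sub>R partial 1 f p
        + (\<chi> i j. h i j p / (\<rho> (p $ 1))\<^sup>2) $ 2 $ j *\<^sub>R partial 2 f p)" for j
      using expand[OF p, of "partial j n p"] unfolding nj[OF p] njn[OF p] by (simp add: h_def n_def F_def)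
  qed
  define \<mu> where "\<mu> = (\<lambda>u. (lam1 u - lam2 u) / 2)"
  have S: "shape_operator f p = twisted_diag (\<lambda>v. a * v) lam1 lam2 p" if "p \<in> ?U" for p
    using twist that unfolding has_twist_def by blast
  have lamH: "lam1 u + lam2 u = H" if "u \<in> ?I" for u
    using cmc[of "pt u 0"] S[of "pt u 0"] that
    by (simp add: mean_curvature_def twisted_diag_eq Let_def trace_def sum_2 field_simps)
  \<comment> \<open>up to the phase \<open>exp (2 a i v)\<close>, the Hopf differential\<close>
  define k where "k = (\<lambda>u. (\<rho> u)\<^sup>2 * \<mu> u)"
  have hS: "h i j p = (\<rho> (p $ 1))\<^sup>2 * twisted_diag (\<lambda>v. a * v) lam1 lam2 p $ i $ j" if p: "p \<in> ?U" for i j p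
    using arg_cong[OF shape_eq[OF p], of "\<lambda>m. m $ i $ j"] S[OF p] pos[OF strip_nth[OF p]] by simp
  have h11: "h 1 1 p = (\<rho> (p $ 1))\<^sup>2 * H / 2 + k (p $ 1) * cos (2 * a * p $ 2)"
    and h12: "h 1 2 p = - (k (p $ 1) * sin (2 * a * p $ 2))"
    and h21: "h 2 1 p = - (k (p $ 1) * sin (2 * a * p $ 2))"
    and h22: "h 2 2 p = (\<rho> (p $ 1))\<^sup>2 * H / 2 - k (p $ 1) * cos (2 * a * p $ 2)" if p: "p \<in> ?U" for p
    using lamH[OF strip_nth[OF p]]
    by (simp_all add: hS[OF p] twisted_diag_eq Let_def k_def \<mu>_def algebra_simps)

  \<comment> \<open>Codazzi: the third derivatives of \<open>f\<close> cancel in \<open>(h\<^sub>2\<^sub>1)\<^sub>v - (h\<^sub>2\<^sub>2)\<^sub>u\<close>\<close>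
  have dh: "h i j differentiable at p" if p: "p \<in> ?U" for i j p
    unfolding h_def using bounded_bilinear.FDERIV[OF bounded_bilinear_inner
      dn[OF p, unfolded frechet_derivative_works] dF'[OF p, unfolded frechet_derivative_works]] differentiableI by blast
  have ph: "partial l (h i j) p = partial l n p \<bullet> partial j (F i) p + n p \<bullet> partial l (partial j (F i)) p" if p: "p \<in> ?U" for i j l p
    unfolding h_def by (rule partial_inner[OF dn[OF p] dF'[OF p]])
  have F221: "partial 1 (partial 2 (F 2)) p = partial 2 (partial 1 (F 2)) p" if "p \<in> ?U" for p
    by (rule partial_commute[OF open_strip that ckF])
  have codazzi: "partial 2 (h 2 1) p - partial 1 (h 2 2) p = - (\<rho> (p $ 1) * \<rho>1 (p $ 1) * H)" if p: "p \<in> ?U" for p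
  proof -
    have r: "\<rho> (p $ 1) > 0" using pos[OF strip_nth[OF p]] .
    have "partial j n p = - ((h 1 j p / (\<rho> (p $ 1))\<^sup>2) *\<^sub>R F 1 p + (h 2 j p / (\<rho> (p $ 1))\<^sup>2) *\<^sub>R F 2 p)" for j
      using expand[OF p, of "partial j n p"] unfolding nj[OF p] njn[OF p] by (simp add: h_def)
    then have nz: "partial j n p \<bullet> z = - ((h 1 j p / (\<rho> (p $ 1))\<^sup>2) * (z \<bullet> F 1 p) + (h 2 j p / (\<rho> (p $ 1))\<^sup>2) * (z \<bullet> F 2 p))" for j z
      by (simp add: inner_diff_left inner_commute[of z])
    have "partial 2 (h 2 1) p - partial 1 (h 2 2) p = partial 2 n p \<bullet> partial 2 (F 1) p - partial 1 n p \<bullet> partial 2 (F 2) p"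
      by (simp add: ph[OF p] F221[OF p] F21[OF p])
    also have "\<dots> = - ((h 1 1 p + h 2 2 p) / (\<rho> (p $ 1))\<^sup>2 * (\<rho> (p $ 1) * \<rho>1 (p $ 1)))"
      unfolding nz chr'[OF p] using r by (simp add: field_simps)
    also have "h 1 1 p + h 2 2 p = (\<rho> (p $ 1))\<^sup>2 * H" by (simp add: h11[OF p] h22[OF p])
    finally show ?thesis using r by (simp add: ac_simps)
  qed
  \<comment> \<open>the differentiability of \<open>k\<close> comes from \<open>h\<^sub>2\<^sub>2\<close>, since \<open>lam1\<close> and \<open>lam2\<close> are arbitrary functions\<close>
  have dk: "(k has_real_derivative 2 * a * k u) (at u)" if u: "u \<in> ?I" for u
  proof -
    have p: "pt u 0 \<in> ?U" using u by simp
    have "((\<lambda>u. (\<rho> u)\<^sup>2 * H / 2 - h 2 2 (pt u 0)) has_real_derivative \<rho> u * \<rho>1 u * H - partial 1 (h 2 2) (pt u 0)) (at u)"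
      using has_vector_derivative_partial_u[OF dh[OF p, of 2 2]]
      by (auto intro!: derivative_eq_intros d1[OF u] simp: has_real_derivative_iff_has_vector_derivative[symmetric])
    then have D: "(k has_real_derivative \<rho> u * \<rho>1 u * H - partial 1 (h 2 2) (pt u 0)) (at u)"
      by (rule has_field_derivative_transform_within_open[OF _ open_einterval u]) (simp add: h22)
    have "((\<lambda>v. h 2 1 (pt u v)) has_real_derivative partial 2 (h 2 1) (pt u 0)) (at 0)"
      using has_vector_derivative_partial_v[OF dh[OF p, of 2 1]]
      by (simp add: has_real_derivative_iff_has_vector_derivative)
    moreover have "((\<lambda>v. h 2 1 (pt u v)) has_real_derivative - (k u * (2 * a))) (at 0)"
    proof -
      have "(\<lambda>v. h 2 1 (pt u v)) = (\<lambda>v. - (k u * sin (2 * a * v)))" using h21 u by simp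
      then show ?thesis by (auto intro!: derivative_eq_intros)
    qed
    ultimately have "partial 2 (h 2 1) (pt u 0) = - (k u * (2 * a))" by (rule DERIV_unique)
    with codazzi[OF p] have "\<rho> u * \<rho>1 u * H - partial 1 (h 2 2) (pt u 0) = 2 * a * k u"
      by (simp add: algebra_simps)
    with D show ?thesis by simp
  qed
  have "\<exists>b. \<forall>u\<in>?I. k u * exp (- (2 * a * u)) = b"
  proof (rule has_field_derivative_zero_constant[OF convex_einterval])
    fix u assume u: "u \<in> ?I"
    have "((\<lambda>u. k u * exp (- (2 * a * u))) has_real_derivative 0) (at u)"
      by (auto intro!: derivative_eq_intros dk[OF u])
    then show "((\<lambda>u. k u * exp (- (2 * a * u))) has_real_derivative 0) (at u within ?I)"
      by (rule has_field_derivative_at_within)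
  qed
  then obtain b where "\<And>u. u \<in> ?I \<Longrightarrow> k u * exp (- (2 * a * u)) = b" by blast
  then have kb: "k u = b * exp (2 * a * u)" if "u \<in> ?I" for u
    using that by (simp add: exp_minus field_simps)

  \<comment> \<open>Gauss: \<open>F 1\<^sub>u \<bullet> F 2\<^sub>v - F 1\<^sub>v \<bullet> F 2\<^sub>u\<close> is intrinsic because the third derivatives of \<open>f\<close> commute\<close>
  have gauss: "(\<rho>1 (p $ 1))\<^sup>2 - \<rho> (p $ 1) * \<rho>2 (p $ 1) = h 1 1 p * h 2 2 p - h 1 2 p * h 1 2 p" if p: "p \<in> ?U" for p
  proof -
    let ?r = "\<rho> (p $ 1)" and ?r1 = "\<rho>1 (p $ 1)" and ?r2 = "\<rho>2 (p $ 1)"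
    have r: "?r > 0" using pos[OF strip_nth[OF p]] .
    have "partial 2 (\<lambda>q. partial 1 (F 1) q \<bullet> F 2 q) p = partial 2 (\<lambda>q. 0) p"
      by (rule partial_cong_open[OF open_strip p chr'(5)])
    then have g1: "partial 2 (partial 1 (F 1)) p \<bullet> F 2 p + partial 1 (F 1) p \<bullet> partial 2 (F 2) p = 0"
      by (simp add: partial_inner[OF dF'[OF p] dF[OF p]] partial_eq[OF has_derivative_const])
    have "partial 1 (\<lambda>q. partial 2 (F 1) q \<bullet> F 2 q) p = partial 1 (\<lambda>q. \<rho> (q $ 1) * \<rho>1 (q $ 1)) p"
      by (rule partial_cong_open[OF open_strip p chr'(3)])
    also have "\<dots> = ?r1 * ?r1 + ?r2 * ?r"
      using partial_of_u[OF DERIV_mult[OF d1[OF strip_nth[OF p]] d2[OF strip_nth[OF p]]], of 1] by simp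
    finally have g2: "partial 2 (partial 1 (F 1)) p \<bullet> F 2 p + partial 2 (F 1) p \<bullet> partial 2 (F 1) p = ?r1 * ?r1 + ?r2 * ?r"
      by (simp add: partial_inner[OF dF'[OF p] dF[OF p]] F112[OF p] F21[OF p])
    have ip: "y \<bullet> z = (y \<bullet> F 1 p) * (z \<bullet> F 1 p) / ?r\<^sup>2 + (y \<bullet> F 2 p) * (z \<bullet> F 2 p) / ?r\<^sup>2 + (n p \<bullet> y) * (n p \<bullet> z)" for y z
      by (subst expand[OF p, of z]) (simp add: inner_add_right inner_commute[of z "n p"] inner_commute[of "n p" y] mult.commute)
    have "partial 1 (F 1) p \<bullet> partial 2 (F 2) p = - (?r1 * ?r1) + h 1 1 p * h 2 2 p"
      unfolding ip[of "partial 1 (F 1) p" "partial 2 (F 2) p"] chr'[OF p] h_def using r by (simp add: power2_eq_square)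
    moreover have "partial 2 (F 1) p \<bullet> partial 2 (F 1) p = ?r1 * ?r1 + h 1 2 p * h 1 2 p"
      unfolding ip[of "partial 2 (F 1) p" "partial 2 (F 1) p"] chr'[OF p] h_def using r by (simp add: power2_eq_square)
    ultimately show ?thesis using g1 g2 by (simp add: power2_eq_square algebra_simps)
  qed
  have "(\<rho>1 u)\<^sup>2 - \<rho> u * \<rho>2 u = 1/4 * H\<^sup>2 * \<rho> u ^ 4 - b\<^sup>2 * exp (4 * a * u)" if u: "u \<in> ?I" for u
  proof -
    have p: "pt u 0 \<in> ?U" using u by simp
    have "exp (4 * a * u) = (exp (2 * a * u))\<^sup>2" by (simp add: power2_eq_square exp_add[symmetric])
    then show ?thesis
      using gauss[OF p] by (simp add: h11[OF p] h22[OF p] h12[OF p] kb[OF u] power2_eq_square power4_eq_xxxx algebra_simps)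
  qed
  then show ?thesis unfolding cmc_profile_equation_def using d1 d2 by blast
qed

section \<open>The correspondence\<close>

theorem theorem1p4:
  fixes u1 u2 :: ereal
  assumes "u1 < u2"
  shows
    "(\<forall>(f :: real^2 \<Rightarrow> real^3) (\<rho> :: real \<Rightarrow> real) (lam1 :: real \<Rightarrow> real) (lam2 :: real \<Rightarrow> real) (a :: real) (H :: real).
        intrinsic_surface_of_revolution u1 u2 \<rho> f \<longrightarrow>
        has_twist u1 u2 f (\<lambda>v. a * v) lam1 lam2 \<longrightarrow>
        (\<forall>p\<in>strip u1 u2. mean_curvature f p = H) \<longrightarrow>
        (\<exists>b::real. cmc_profile_equation u1 u2 H a b \<rho>))
     \<and>
     (\<forall>(H :: real) (a :: real) (b :: real) (\<rho> :: real \<Rightarrow> real) (lam1 :: real \<Rightarrow> real) (lam2 :: real \<Rightarrow> real).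
        (\<forall>u\<in>einterval u1 u2. \<rho> u > 0) \<longrightarrow>
        cmc_profile_equation u1 u2 H a b \<rho> \<longrightarrow>
        (\<forall>u\<in>einterval u1 u2. lam1 u = H / 2 + b * (exp (2 * a * u) / (\<rho> u)\<^sup>2)) \<longrightarrow>
        (\<forall>u\<in>einterval u1 u2. lam2 u = H / 2 - b * (exp (2 * a * u) / (\<rho> u)\<^sup>2)) \<longrightarrow>
        gauss_equation (strip u1 u2) (revolution_metric \<rho>) (twisted_diag (\<lambda>v. a * v) lam1 lam2) \<and>
        codazzi_equations (strip u1 u2) (revolution_metric \<rho>) (twisted_diag (\<lambda>v. a * v) lam1 lam2) \<and>
        (\<exists>f :: real^2 \<Rightarrow> real^3.
            intrinsic_surface_of_revolution u1 u2 \<rho> f \<and>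
            has_twist u1 u2 f (\<lambda>v. a * v) lam1 lam2 \<and>
            (\<forall>p\<in>strip u1 u2. mean_curvature f p = H)))"
proof (intro conjI allI impI)
  fix f :: "real^2 \<Rightarrow> real^3" and \<rho> lam1 lam2 :: "real \<Rightarrow> real" and a H :: real
  assume "intrinsic_surface_of_revolution u1 u2 \<rho> f" "has_twist u1 u2 f (\<lambda>v. a * v) lam1 lam2"
    "\<forall>p\<in>strip u1 u2. mean_curvature f p = H"
  then show "\<exists>b. cmc_profile_equation u1 u2 H a b \<rho>" by (intro cmc_twisted_profile) auto
next
  fix H a b :: real and \<rho> lam1 lam2 :: "real \<Rightarrow> real"
  assume pos: "\<forall>u\<in>einterval u1 u2. \<rho> u > 0" and eq: "cmc_profile_equation u1 u2 H a b \<rho>"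
    and lam: "\<forall>u\<in>einterval u1 u2. lam1 u = H / 2 + b * (exp (2 * a * u) / (\<rho> u)\<^sup>2)"
      "\<forall>u\<in>einterval u1 u2. lam2 u = H / 2 - b * (exp (2 * a * u) / (\<rho> u)\<^sup>2)"
  obtain \<rho>1 \<rho>2 where "cmc_profile u1 u2 H a b \<rho> \<rho>1 \<rho>2"
    using eq pos unfolding cmc_profile_equation_def cmc_profile_def by blast
  then interpret cmc_profile u1 u2 H a b \<rho> \<rho>1 \<rho>2 .
  note S = twisted_diag_eq_shape[OF _ lam]
  show "gauss_equation (strip u1 u2) (revolution_metric \<rho>) (twisted_diag (\<lambda>v. a * v) lam1 lam2)"
    by (rule gauss_equation_shape) (rule S)
  show "codazzi_equations (strip u1 u2) (revolution_metric \<rho>) (twisted_diag (\<lambda>v. a * v) lam1 lam2)"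
    by (rule codazzi_equations_shape) (rule S)
  obtain t0 where "t0 \<in> einterval u1 u2" using einterval_nonempty[OF assms] by blast
  then obtain f where f: "intrinsic_surface_of_revolution u1 u2 \<rho> f"
    "\<And>p. p \<in> strip u1 u2 \<Longrightarrow> shape_operator f p = shape p"
    using surface_exists by blast
  have "has_twist u1 u2 f (\<lambda>v. a * v) lam1 lam2"
    unfolding has_twist_def using f(2) S by (auto intro!: derivative_intros)
  moreover have "\<forall>p\<in>strip u1 u2. mean_curvature f p = H"
    using f(2) by (simp add: mean_curvature_def shape_def trace_def sum_2)
  ultimately show "\<exists>f. intrinsic_surface_of_revolution u1 u2 \<rho> f \<and> has_twist u1 u2 f (\<lambda>v. a * v) lam1 lam2 \<and>
      (\<forall>p\<in>strip u1 u2. mean_curvature f p = H)"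
    using f(1) by blast
qed

end
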